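(* Let $\mathbb{K}\subset\mathbb{C}$ be a number field with ring of integers $\mathcal{O}_{\mathbb{K}}$; let $\mathbb{L}=\mathbb{R}$ if $\mathbb{K}\subset\mathbb{R}$ and $\mathbb{L}=\mathbb{C}$ otherwise. Let $(Q_n)$ be an increasing sequence of positive real numbers with limit $+\infty$ such that $Q_{n+1}=Q_n^{1+o(1)}$. Let $T\ge1$, let $c_1,\dots,c_T$ be non-zero complex numbers and let $\zeta_1,\dots,\zeta_T$ be pairwise distinct complex numbers with $|\zeta_t|=1$ for all $t$. Let $\vartheta_1,\dots,\vartheta_N\in\mathbb{L}$. Assume that for some $\tau>0$ there exist $N$ sequences $(p_{j,n})_{n\ge0}$, $1\le j\le N$, such that for all $j,n$: $p_{j,n}\in\mathcal{O}_{\mathbb{K}}$, all Galois conjugates of $p_{j,n}$ have modulus less than $Q_n^{1+o(1)}$, and $$\sum_{j=1}^N p_{j,n}\vartheta_j=Q_n^{-\tau+o(1)}\Big(\sum_{t=1}^T c_t\zeta_t^n+o(1)\Big).$$ Then $\dim_{\mathbb{K}}\mathrm{Span}_{\mathbb{K}}(\vartheta_1,\dots,\vartheta_N)\ge \frac{\tau+1}{[\mathbb{K}:\mathbb{Q}]}$.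
   Context: Throughout, $o(1)$ denotes any sequence (indexed by $n$) tending to $0$ as $n\to\infty$. *)

theory Defs
  imports Complex_Main "HOL-Algebra.Algebraic_Closure_Type"
begin

abbreviation complex_field :: "complex ring" where
  "complex_field \<equiv> ring_of_type_algebra"

definition number_field :: "complex set \<Rightarrow> bool" where
  "number_field K \<longleftrightarrow>
     subfield K complex_field \<and> ring.finite_dimension complex_field \<rat> K"

definition number_field_degree :: "complex set \<Rightarrow> nat" where
  "number_field_degree K = (ring.dim complex_field over \<rat>) K"

definition ring_of_integers :: "complex set \<Rightarrow> complex set" where
  "ring_of_integers K = {x \<in> K. algebraic_int x}"

(* The complex roots of the minimal polynomial of x over the rationals; the minimal polynomial
   is the unique monic irreducible rational polynomial q that vanishes at x.
   The qualified name avoids the notion of HOL-Algebra.Divisibility. *)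
definition galois_conjugates :: "complex \<Rightarrow> complex set" where
  "galois_conjugates x =
     {z. \<exists>q :: rat poly. lead_coeff q = 1 \<and> Factorial_Ring.irreducible q \<and>
           poly (map_poly of_rat q) x = 0 \<and> poly (map_poly of_rat q) z = 0}"

end

theory Submission
  imports Defs "HOL-Analysis.Kronecker_Approximation_Theorem" "Jordan_Normal_Form.Char_Poly"
begin

text \<open>
  Let \<open>V\<close> be the \<open>K\<close>-span of the \<open>\<theta>\<^sub>j\<close> and \<open>M = [K : \<rat>] dim\<^sub>K V\<close> its dimension over \<open>\<rat>\<close>.
  Expanding \<open>p\<^sub>j \<theta>\<^sub>j\<close> in a \<open>\<rat>\<close>-basis of \<open>V\<close>, the coefficients are rational linear functionals of
  \<open>p\<^sub>j\<close>.  Every such functional on \<open>K\<close> is a combination of field embeddings with algebraic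
  coefficients, so on integers of \<open>K\<close> it has bounded denominator and is bounded by the conjugates.
  This gives integer linear forms in \<open>M\<close> fixed numbers with coefficients of size \<open>Q\<^sub>n\<^bsup>1+o(1)\<^esup>\<close>.

  After taking real parts (up to a factor 1 or \<open>\<i>\<close>), the exponential sum stays bounded away from 0
  at least once in every window of bounded length: the polynomial vanishing at all
  frequencies but one isolates a single term.  Hence for every large \<open>Y\<close> there is a form with
  coefficients of size \<open>Y\<^bsup>1+o(1)\<^esup>\<close> and exact value of size \<open>Y\<^bsup>-\<tau>+o(1)\<^esup>\<close>.

  If \<open>M < \<tau> + 1\<close>, Dirichlet's theorem provides an integer vector \<open>w\<close> close to a multiple \<open>q x\<close> of
  the vector of the \<open>M\<close> real numbers.  Choosing \<open>Y\<close> slightly larger than \<open>q\<^bsup>1/\<tau>\<^esup>\<close>, the value of the form at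
  \<open>w\<close> is an integer that is non-zero but smaller than 1.
\<close>

section \<open>Integer linear forms in real numbers\<close>

text \<open>Dirichlet's theorem is applied to the ratios \<open>x s / x s0\<close> with
  \<open>s \<noteq> s0\<close>. The coordinate \<open>s0\<close> is matched exactly, so only
  \<open>M - 1\<close> numbers are approximated; this gives the exponent \<open>M - 1\<close> in the
  bound for \<open>q\<close> and, in the end, the summand 1 in \<tau> + 1.\<close>

lemma simultaneous_approximation_homogeneous:
  fixes x :: "nat \<Rightarrow> real"
  assumes "s0 < M" "x s0 \<noteq> 0" "B > (0::nat)"
  obtains q :: int and w :: "nat \<Rightarrow> int"
  where "0 < q" "q \<le> int (B ^ (M - 1))"
    and "\<And>s. s < M \<Longrightarrow> \<bar>w s * x s0 - q * x s\<bar> \<le> \<bar>x s0\<bar> / B"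
proof -
  \<comment> \<open>\<open>f\<close> enumerates the indices different from \<open>s0\<close>; the
    inner conditional in \<open>w\<close> below is its inverse.\<close>
  define f where "f = (\<lambda>i. if i < s0 then i else Suc i)"
  obtain q p where q: "0 < q" "q \<le> int (B ^ (M - 1))"
    and p: "\<And>i. i < M - 1 \<Longrightarrow> \<bar>of_int q * (x (f i) / x s0) - of_int (p i)\<bar> < 1 / B"
    using Dirichlet_approx_simult[OF assms(3), where n = "M - 1" and \<theta> = "\<lambda>i. x (f i) / x s0"]
    by metis
  define w where "w = (\<lambda>s. if s = s0 then q else p (if s < s0 then s else s - 1))"
  show thesis
  proof (rule that[OF q])
    fix s assume s: "s < M"
    show "\<bar>w s * x s0 - q * x s\<bar> \<le> \<bar>x s0\<bar> / B"
    proof (cases "s = s0")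
      case False
      define i where "i = (if s < s0 then s else s - 1)"
      have i: "i < M - 1" "f i = s" "w s = p i"
        using s False assms(1) by (auto simp: i_def f_def w_def)
      have "w s * x s0 - q * x s = - x s0 * (of_int q * (x (f i) / x s0) - of_int (p i))"
        using i assms(2) by (simp add: field_simps)
      hence "\<bar>w s * x s0 - q * x s\<bar> = \<bar>x s0\<bar> * \<bar>of_int q * (x (f i) / x s0) - of_int (p i)\<bar>"
        by (simp add: abs_mult)
      also have "\<dots> \<le> \<bar>x s0\<bar> * (1 / B)"
        using p[OF i(1)] by (intro mult_left_mono) auto
      finally show ?thesis by simp
    qed (simp add: w_def)
  qed
qed

text \<open>If \<open>M - 1 < \<tau>\<close>, simultaneous approximation beats the size of the
  forms. The integer value \<open>Z\<close> of a form at \<open>k * w\<close> satisfies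
  \<open>Z * x s0 = y * \<Lambda> + err\<close>; the scale \<open>Y\<close> of the form is tuned so
  that \<open>y * \<Lambda>\<close> is small, and the approximation is good enough for
  \<open>err\<close> to be smaller still. The lower bound for the forms then keeps \<open>Z\<close>
  away from 0 although its modulus is less than 1.\<close>

lemma card_ge_of_small_integer_forms:
  fixes x :: "nat \<Rightarrow> real" and M :: nat and \<tau> :: real
  assumes \<tau>: "\<tau> > 0"
    and forms: "\<And>e. e > 0 \<Longrightarrow> \<forall>\<^sub>F Y in at_top. \<exists>m :: nat \<Rightarrow> int.
           (\<forall>s<M. \<bar>real_of_int (m s)\<bar> \<le> Y powr (1 + e)) \<and>
           Y powr (- \<tau> - e) \<le> \<bar>\<Sum>s<M. m s * x s\<bar> \<and>
           \<bar>\<Sum>s<M. m s * x s\<bar> \<le> Y powr (- \<tau> + e)"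
  shows "\<tau> + 1 \<le> real M"
proof (rule ccontr)
  assume neg: "\<not> \<tau> + 1 \<le> real M"
  have "\<exists>s0<M. x s0 \<noteq> 0"
  proof (rule ccontr)
    assume "\<not> (\<exists>s0<M. x s0 \<noteq> 0)"
    hence "(\<Sum>s<M. m s * x s) = 0" for m :: "nat \<Rightarrow> int"
      by (intro sum.neutral) auto
    with forms[of 1] have "\<forall>\<^sub>F Y in at_top. Y powr (- \<tau> - 1) \<le> (0::real)"
      by (auto elim!: eventually_mono)
    with eventually_gt_at_top[of "0::real"] have "\<forall>\<^sub>F Y::real in at_top. False"
    proof eventually_elim
      case (elim Y)
      have "0 < Y powr (- \<tau> - 1)" using elim by simp
      with elim show False by linarith
    qed
    thus False by simp
  qed
  then obtain s0 where s0: "s0 < M" "x s0 \<noteq> 0" by blast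
  define d where "d = real (M - 1)"
  have d: "0 \<le> d" "d < \<tau>" using s0 neg by (auto simp: d_def)
  \<comment> \<open>Room for a small \<open>g\<close> exists because \<open>d / \<tau> < 1\<close>,
    which is the case \<open>g = 0\<close> of the inequality.\<close>
  obtain g where g: "g > 0" "d * ((1 + g) / \<tau> + 2 * g) < 1"
  proof -
    define \<mu> where "\<mu> = d / \<tau>"
    have \<mu>: "0 \<le> \<mu>" "\<mu> < 1" using d \<tau> by (auto simp: \<mu>_def)
    define g where "g = (1 - \<mu>) / (2 * (\<mu> + 2 * d + 1))"
    have "g > 0" using \<mu> d by (simp add: g_def)
    have "g * (2 * (\<mu> + 2 * d + 1)) = 1 - \<mu>"
      using \<mu> d by (simp add: g_def)
    hence "g * (\<mu> + 2 * d) < 1 - \<mu>" using \<open>g > 0\<close> \<mu> d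
      by (simp add: algebra_simps)
    moreover have "d * ((1 + g) / \<tau> + 2 * g) = \<mu> + g * (\<mu> + 2 * d)"
      by (simp add: \<mu>_def algebra_simps add_divide_distrib)
    ultimately show ?thesis using that[of g] \<open>g > 0\<close> by simp
  qed
  \<comment> \<open>\<open>A\<close> is the exponent of \<open>y\<close> in the quotient of the
    coefficient bound \<open>Y powr (1 + e)\<close>, which is \<open>y\<close> to the power \<sigma>
    + g/2, by the lower bound for \<open>y * \<Lambda>\<close>, which is \<open>y\<close> to the
    power -3g/2.\<close>
  define A where "A = (1 + g) / \<tau> + 2 * g"
  define \<kappa> where "\<kappa> = 1 - d * A"
  have \<kappa>: "\<kappa> > 0" using g by (simp add: \<kappa>_def A_def)
  \<comment> \<open>The exponent of \<open>k\<close> in the bound for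
    \<open>err / (y * \<Lambda>)\<close> will be
    \<open>H * A + 1 - h = A + 1 - h * \<kappa>\<close>; this \<open>h\<close> makes it
    negative.\<close>
  obtain h :: nat where h: "(A + 1) / \<kappa> < h" using reals_Archimedean2 by blast
  define \<sigma> where "\<sigma> = (1 + g) / \<tau>"
  \<comment> \<open>With \<open>\<sigma> * e = g / 2\<close> and
    \<open>\<sigma> * \<tau> = 1 + g\<close>, the modulus of \<open>y * \<Lambda>\<close> lies
    between \<open>y\<close> to the powers -3g/2 and -g/2.\<close>
  define e where "e = g / (2 * \<sigma>)"
  have \<sigma>: "\<sigma> > 0" using g \<tau> by (simp add: \<sigma>_def)
  have e: "e > 0" "\<sigma> * e = g / 2" using g \<sigma> by (auto simp: e_def)
  have \<sigma>\<tau>: "\<sigma> * \<tau> = 1 + g" using \<tau> by (simp add: \<sigma>_def)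
  \<comment> \<open>Exponents in terms of \<open>k\<close>: \<open>y\<close> is at most
    \<open>k ^ H\<close>, the error is at most a constant times \<open>k powr E\<close>, and
    \<open>y * \<Lambda>\<close> has modulus at least \<open>k powr (- F)\<close>.\<close>
  define H where "H = h * (M - 1) + 1"
  define E where "E = H * (\<sigma> * (1 + e)) + 1 - h"
  define F where "F = real H * (3 * g / 2)"
  have H: "real H = h * d + 1" by (simp add: H_def d_def)
  have "E + F = H * (\<sigma> + \<sigma> * e + 3 * g / 2) + 1 - h"
    by (simp add: E_def F_def algebra_simps)
  also have "\<dots> = H * A + 1 - h"
    unfolding e(2) by (simp add: A_def \<sigma>_def[symmetric] algebra_simps)
  also have "\<dots> = A + 1 - h * \<kappa>"
    by (simp add: H \<kappa>_def algebra_simps)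
  also have "\<dots> < 0" using h \<kappa> by (simp add: field_simps)
  finally have EF: "E + F < 0" .
  have F: "F \<ge> 0" using g by (simp add: F_def)
  obtain Y0 where Y0: "\<And>Y. Y \<ge> Y0 \<Longrightarrow> \<exists>m :: nat \<Rightarrow> int.
           (\<forall>s<M. \<bar>real_of_int (m s)\<bar> \<le> Y powr (1 + e)) \<and>
           Y powr (- \<tau> - e) \<le> \<bar>\<Sum>s<M. m s * x s\<bar> \<and>
           \<bar>\<Sum>s<M. m s * x s\<bar> \<le> Y powr (- \<tau> + e)"
    using forms[OF e(1)] unfolding eventually_at_top_linorder by blast
  have lim: "((\<lambda>k. real k powr a) \<longlongrightarrow> 0) sequentially" if "a < 0" for a
    using that by (rule tendsto_neg_powr) (rule filterlim_real_sequentially)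
  \<comment> \<open>The four conditions on \<open>k\<close> ensure, in this order: a form exists at
    the scale \<open>Y\<close>; \<open>y * \<Lambda>\<close> is below half of
    \<open>\<bar>x s0\<bar>\<close>; so is \<open>err\<close>; and \<open>err\<close> is smaller
    than \<open>y * \<Lambda>\<close>.\<close>
  have "\<forall>\<^sub>F k in sequentially. real k powr \<sigma> \<ge> Y0"
    using filterlim_compose[OF real_powr_at_top[OF \<sigma>] filterlim_real_sequentially]
    by (simp add: filterlim_at_top)
  moreover have "\<forall>\<^sub>F k in sequentially. real k powr (- g / 2) < \<bar>x s0\<bar> / 2"
    using g s0 by (intro order_tendstoD(2)[OF lim]) auto
  moreover have "\<forall>\<^sub>F k in sequentially. real M * real k powr E < 1 / 2"
    using EF F by (intro order_tendstoD(2)[OF tendsto_mult_right_zero[OF lim]]) auto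
  moreover have "\<forall>\<^sub>F k in sequentially. \<bar>x s0\<bar> * M * real k powr (E + F) < 1"
    using EF F by (intro order_tendstoD(2)[OF tendsto_mult_right_zero[OF lim]]) auto
  moreover have "\<forall>\<^sub>F k in sequentially. k \<ge> (1::nat)" by (rule eventually_ge_at_top)
  ultimately have "\<forall>\<^sub>F k in sequentially. real k powr \<sigma> \<ge> Y0 \<and> real k powr (- g / 2) < \<bar>x s0\<bar> / 2 \<and>
      real M * real k powr E < 1 / 2 \<and> \<bar>x s0\<bar> * M * real k powr (E + F) < 1 \<and> k \<ge> 1"
    by eventually_elim auto
  then obtain k :: nat where k: "real k powr \<sigma> \<ge> Y0" "real k powr (- g / 2) < \<bar>x s0\<bar> / 2"
      "real M * real k powr E < 1 / 2" "\<bar>x s0\<bar> * M * real k powr (E + F) < 1" "k \<ge> 1"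
    unfolding eventually_sequentially by blast
  obtain q :: int and w :: "nat \<Rightarrow> int" where q: "0 < q" "q \<le> int ((k ^ h) ^ (M - 1))"
    and w: "\<And>s. s < M \<Longrightarrow> \<bar>w s * x s0 - q * x s\<bar> \<le> \<bar>x s0\<bar> / real (k ^ h)"
    by (rule simultaneous_approximation_homogeneous[of s0 M x "k ^ h"]) (use s0 k(5) in auto)
  \<comment> \<open>The factor \<open>k\<close> makes \<open>y\<close> large even if \<open>q\<close> stays bounded; this replaces linear independence.\<close>
  define y where "y = real k * real_of_int q"
  have yk: "y \<ge> k"
  proof -
    have "real k * 1 \<le> real k * real_of_int q" using q by (intro mult_left_mono) auto
    thus ?thesis by (simp add: y_def)
  qed
  have yH: "y \<le> real k ^ H"
  proof -
    have "real_of_int q \<le> real_of_int (int ((k ^ h) ^ (M - 1)))" using q by linarith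
    hence "y \<le> real k * (real k ^ h) ^ (M - 1)" unfolding y_def by (intro mult_left_mono) auto
    thus ?thesis by (simp add: H_def power_mult)
  qed
  have k1: "real k \<ge> 1" "real k > 0" and y: "y > 0" using k(5) yk by auto
  \<comment> \<open>The exponent \<sigma> slightly exceeds 1/\<tau>, so that
    \<open>y * Y powr (- \<tau>) = y powr (- g)\<close> just tends to 0.\<close>
  define Y where "Y = y powr \<sigma>"
  have "Y \<ge> real k powr \<sigma>" unfolding Y_def using yk \<sigma> k1 by (intro powr_mono2) auto
  then obtain m :: "nat \<Rightarrow> int" where m: "\<And>s. s < M \<Longrightarrow> \<bar>real_of_int (m s)\<bar> \<le> Y powr (1 + e)"
      "Y powr (- \<tau> - e) \<le> \<bar>\<Sum>s<M. m s * x s\<bar>" "\<bar>\<Sum>s<M. m s * x s\<bar> \<le> Y powr (- \<tau> + e)"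
    using Y0[of Y] k(1) by force
  define \<Lambda> where "\<Lambda> = (\<Sum>s<M. m s * x s)"
  define Z where "Z = (\<Sum>s<M. m s * (int k * w s))"
  define err where "err = (\<Sum>s<M. m s * (k * (w s * x s0 - q * x s)))"
  have Z: "Z * x s0 = y * \<Lambda> + err"
    by (simp add: Z_def \<Lambda>_def err_def y_def sum_distrib_left sum_distrib_right sum.distrib[symmetric] algebra_simps)
  have kH: "(real k ^ H) powr a = real k powr (real H * a)" for a :: real
    using k1 by (simp add: powr_powr flip: powr_realpow)
  have "\<bar>err\<bar> \<le> (\<Sum>s<M. Y powr (1 + e) * (k * (\<bar>x s0\<bar> / real (k ^ h))))"
    unfolding err_def
  proof (rule order.trans[OF sum_abs], rule sum_mono)
    fix s assume s: "s \<in> {..<M}"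
    have "\<bar>m s * (k * (w s * x s0 - q * x s))\<bar> = \<bar>real_of_int (m s)\<bar> * (k * \<bar>w s * x s0 - q * x s\<bar>)"
      by (simp add: abs_mult)
    also have "\<dots> \<le> Y powr (1 + e) * (k * (\<bar>x s0\<bar> / real (k ^ h)))"
      using m(1)[of s] w[of s] s by (intro mult_mono) auto
    finally show "\<bar>m s * (k * (w s * x s0 - q * x s))\<bar> \<le> Y powr (1 + e) * (k * (\<bar>x s0\<bar> / real (k ^ h)))" .
  qed
  also have "\<dots> = \<bar>x s0\<bar> * M * (y powr (\<sigma> * (1 + e)) * (k * real k powr (- real h)))"
    using k1 by (simp add: Y_def powr_powr powr_minus powr_realpow divide_inverse)
  also have "\<dots> \<le> \<bar>x s0\<bar> * M * (real k powr (H * (\<sigma> * (1 + e))) * (k * real k powr (- real h)))"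
  proof -
    have "y powr (\<sigma> * (1 + e)) \<le> (real k ^ H) powr (\<sigma> * (1 + e))"
      using yH y \<sigma> e(1) by (intro powr_mono2) auto
    thus ?thesis unfolding kH by (intro mult_left_mono mult_right_mono) auto
  qed
  also have "\<dots> = \<bar>x s0\<bar> * M * real k powr E"
  proof -
    have "real k powr E = real k powr (H * (\<sigma> * (1 + e))) * (real k powr 1 * real k powr (- real h))"
      unfolding E_def powr_add[symmetric] by (simp add: algebra_simps)
    thus ?thesis using k1 by simp
  qed
  finally have err: "\<bar>err\<bar> \<le> \<bar>x s0\<bar> * M * real k powr E" .
  have yY: "y * Y powr a = y powr (1 + \<sigma> * a)" for a
    using y by (simp add: Y_def powr_powr powr_add)
  have "\<bar>y * \<Lambda>\<bar> \<le> y * Y powr (- \<tau> + e)"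
    using m(3) y by (simp add: \<Lambda>_def abs_mult)
  also have "\<dots> = y powr (- g / 2)"
  proof -
    have "1 + \<sigma> * (- \<tau> + e) = - g / 2" using \<sigma>\<tau> e(2) by (simp add: algebra_simps)
    thus ?thesis unfolding yY by simp
  qed
  also have "\<dots> \<le> real k powr (- g / 2)" using k1 yk g by (intro powr_mono2') auto
  finally have up: "\<bar>y * \<Lambda>\<bar> < \<bar>x s0\<bar> / 2" using k(2) by linarith
  have "real k powr (- F) = (real k ^ H) powr (- (3 * g / 2))"
    unfolding kH by (simp add: F_def)
  also have "\<dots> \<le> y powr (- (3 * g / 2))" using yH y g by (intro powr_mono2') auto
  also have "\<dots> = y * Y powr (- \<tau> - e)"
  proof -
    have "1 + \<sigma> * (- \<tau> - e) = - (3 * g / 2)" using \<sigma>\<tau> e(2) by (simp add: algebra_simps)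
    thus ?thesis unfolding yY by simp
  qed
  also have "\<dots> \<le> \<bar>y * \<Lambda>\<bar>" using m(2) y by (simp add: \<Lambda>_def abs_mult)
  finally have low: "real k powr (- F) \<le> \<bar>y * \<Lambda>\<bar>" .
  have "\<bar>x s0\<bar> * M * real k powr E = \<bar>x s0\<bar> * M * real k powr (E + F) * real k powr (- F)"
    by (simp add: powr_add[symmetric] mult.assoc)
  also have "\<dots> < 1 * real k powr (- F)" using k(4) k1 by (intro mult_strict_right_mono) auto
  finally have "\<bar>err\<bar> < \<bar>y * \<Lambda>\<bar>" using err low by linarith
  \<comment> \<open>The error cannot cancel the main term, so \<open>Z\<close> is non-zero; as both
    terms are below half of \<open>\<bar>x s0\<bar>\<close>, the integer \<open>Z\<close> has
    modulus less than 1.\<close>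
  hence "Z * x s0 \<noteq> 0" unfolding Z by linarith
  moreover have "\<bar>Z * x s0\<bar> < \<bar>x s0\<bar> * 1"
  proof -
    have "\<bar>x s0\<bar> * (M * real k powr E) < \<bar>x s0\<bar> * (1 / 2)"
      using k(3) s0 by (intro mult_strict_left_mono) auto
    hence "\<bar>err\<bar> < \<bar>x s0\<bar> / 2" using err by (simp add: mult.assoc)
    thus ?thesis using up unfolding Z by linarith
  qed
  hence "\<bar>real_of_int Z\<bar> < 1" using s0 by (simp add: abs_mult)
  hence "Z = 0" by linarith
  ultimately show False by simp
qed

section \<open>Lower bounds for exponential sums in windows of bounded length\<close>

text \<open>Let the polynomial \<open>P\<close> with roots at all frequencies except \<xi> act on
  the sequence by index shifts. Only the term of \<xi> survives, and it has constant non-zero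
  modulus, so \<open>degree P + 1\<close> consecutive values cannot all be small. Frequencies may
  repeat in the family; what counts is the total coefficient at \<xi>.\<close>

lemma exponential_sum_bounded_below:
  fixes c \<zeta> :: "'a \<Rightarrow> complex"
  assumes I: "finite I" and \<xi>: "cmod \<xi> = 1"
    and A: "(\<Sum>t | t \<in> I \<and> \<zeta> t = \<xi>. c t) \<noteq> 0"
  obtains \<kappa> :: real and G :: nat where "\<kappa> > 0"
    "\<And>n. \<exists>i<G. \<kappa> \<le> cmod (\<Sum>t\<in>I. c t * \<zeta> t ^ (n + i))"
proof -
  define S where "S = (\<lambda>n. \<Sum>t\<in>I. c t * \<zeta> t ^ n)"
  define P where "P = (\<Prod>z\<in>\<zeta> ` I - {\<xi>}. [:- z, 1:])"
  define A where "A = (\<Sum>t | t \<in> I \<and> \<zeta> t = \<xi>. c t)"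
  define d where "d = degree P"
  define s where "s = (\<Sum>i\<le>d. cmod (coeff P i))"
  define b where "b = cmod (A * poly P \<xi>)"
  \<comment> \<open>Any bound \<kappa> with \<open>s * \<kappa> < b\<close> works; the denominator
    \<open>s + 1\<close> makes the inequality strict.\<close>
  define \<kappa> where "\<kappa> = b / (s + 1)"
  have P0: "poly P \<xi> \<noteq> 0" using I by (auto simp: P_def poly_prod)
  have P1: "poly P (\<zeta> t) = 0" if "t \<in> I" "\<zeta> t \<noteq> \<xi>" for t
    using I that by (auto simp: P_def poly_prod intro!: bexI[of _ "\<zeta> t"])
  have b: "b > 0" using P0 A by (simp add: b_def A_def)
  have s: "s \<ge> 0" by (simp add: s_def sum_nonneg)
  have key: "(\<Sum>i\<le>d. coeff P i * S (n + i)) = A * poly P \<xi> * \<xi> ^ n" for n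
  proof -
    have "(\<Sum>i\<le>d. coeff P i * S (n + i)) = (\<Sum>i\<le>d. \<Sum>t\<in>I. coeff P i * (c t * \<zeta> t ^ (n + i)))"
      by (simp add: S_def sum_distrib_left)
    also have "\<dots> = (\<Sum>t\<in>I. \<Sum>i\<le>d. coeff P i * (c t * \<zeta> t ^ (n + i)))" by (rule sum.swap)
    also have "\<dots> = (\<Sum>t\<in>I. c t * \<zeta> t ^ n * poly P (\<zeta> t))"
      by (simp add: poly_altdef d_def sum_distrib_left power_add mult_ac)
    also have "\<dots> = (\<Sum>t | t \<in> I \<and> \<zeta> t = \<xi>. c t * \<zeta> t ^ n * poly P (\<zeta> t))"
      using I P1 by (intro sum.mono_neutral_right) auto
    also have "\<dots> = (\<Sum>t | t \<in> I \<and> \<zeta> t = \<xi>. c t * (poly P \<xi> * \<xi> ^ n))"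
      by (intro sum.cong) auto
    also have "\<dots> = A * poly P \<xi> * \<xi> ^ n" by (simp add: A_def sum_distrib_right mult.assoc)
    finally show ?thesis .
  qed
  have "\<exists>i<Suc d. \<kappa> \<le> cmod (S (n + i))" for n
  proof (rule ccontr)
    assume "\<not> (\<exists>i<Suc d. \<kappa> \<le> cmod (S (n + i)))"
    hence small: "cmod (S (n + i)) \<le> \<kappa>" if "i \<le> d" for i using that by (force simp: less_Suc_eq_le)
    have "b = cmod (\<Sum>i\<le>d. coeff P i * S (n + i))"
      unfolding key by (simp add: b_def norm_mult norm_power \<xi>)
    also have "\<dots> \<le> (\<Sum>i\<le>d. cmod (coeff P i) * \<kappa>)"
      using small by (intro sum_norm_le) (auto simp: norm_mult intro: mult_left_mono)
    also have "\<dots> = s * \<kappa>" by (simp add: s_def sum_distrib_right)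
    also have "\<dots> < b" using b s by (simp add: \<kappa>_def field_simps)
    finally show False by simp
  qed
  moreover have "\<kappa> > 0" using b s by (simp add: \<kappa>_def)
  ultimately show thesis using that[of \<kappa> "Suc d"] by (simp add: S_def)
qed

text \<open>Twice the real part is again an exponential sum, over the frequencies and their
  conjugates. A conjugate may coincide with \<open>\<zeta> 1\<close> and cancel its coefficient;
  this cannot happen both for \<open>u = 1\<close> and for \<open>u = \<i>\<close>.\<close>

lemma Re_exponential_sum_bounded_below:
  fixes c \<zeta> :: "nat \<Rightarrow> complex"
  assumes T: "T \<ge> 1" and c: "c 1 \<noteq> 0" and \<zeta>: "inj_on \<zeta> {1..T}" "cmod (\<zeta> 1) = 1"
  obtains u :: complex and \<kappa> :: real and G :: nat where "cmod u = 1" "\<kappa> > 0"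
    "\<And>n. \<exists>i<G. \<kappa> \<le> \<bar>Re (u * (\<Sum>t=1..T. c t * \<zeta> t ^ (n + i)))\<bar>"
proof -
  \<comment> \<open>The coefficient at the frequency \<open>\<zeta> 1\<close> contributed by the
    conjugate sum, before the factor \<open>cnj u\<close>.\<close>
  define c' where "c' = (\<Sum>t | t \<in> {1..T} \<and> cnj (\<zeta> t) = \<zeta> 1. cnj (c t))"
  obtain u where u: "u \<in> {1, \<i>}" "u * c 1 + cnj u * c' \<noteq> 0"
  proof (cases "c 1 + c' = 0")
    case True
    hence "c 1 - c' \<noteq> 0" using c by (auto simp: add_eq_0_iff)
    hence "\<i> * c 1 + cnj \<i> * c' \<noteq> 0" by (simp add: right_diff_distrib[symmetric])
    thus ?thesis using that[of \<i>] by simp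
  next
    case False
    thus ?thesis using that[of 1] by simp
  qed
  \<comment> \<open>The flag \<open>True\<close> marks an original term and \<open>False\<close> its
    complex conjugate.\<close>
  define I where "I = {1..T} \<times> (UNIV :: bool set)"
  define C where "C = (\<lambda>(t, b). if b then u * c t else cnj (u * c t))"
  define Z where "Z = (\<lambda>(t, b). if b then \<zeta> t else cnj (\<zeta> t))"
  have split: "(\<Sum>i\<in>I. f i) = (\<Sum>t=1..T. f (t, True) + f (t, False))" for f :: "nat \<times> bool \<Rightarrow> complex"
  proof -
    have "(\<Sum>i\<in>I. f i) = (\<Sum>t=1..T. \<Sum>b\<in>UNIV. f (t, b))"
      unfolding I_def sum.cartesian_product by simp
    thus ?thesis by (simp add: UNIV_bool add.commute)
  qed
  have "(\<Sum>i | i \<in> I \<and> Z i = \<zeta> 1. C i) = (\<Sum>i\<in>I. if Z i = \<zeta> 1 then C i else 0)"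
    by (simp add: I_def sum.If_cases Int_def)
  also have "\<dots> = (\<Sum>t=1..T. if \<zeta> t = \<zeta> 1 then u * c t else 0) +
      (\<Sum>t=1..T. if cnj (\<zeta> t) = \<zeta> 1 then cnj (u * c t) else 0)"
    unfolding split Z_def C_def prod.case if_True if_False by (rule sum.distrib)
  also have "(\<Sum>t=1..T. if \<zeta> t = \<zeta> 1 then u * c t else 0) = (\<Sum>t=1..T. if t = 1 then u * c t else 0)"
    using T inj_onD[OF \<zeta>(1), of _ 1] by (intro sum.cong) auto
  also have "\<dots> = u * c 1" using T by simp
  also have "(\<Sum>t=1..T. if cnj (\<zeta> t) = \<zeta> 1 then cnj (u * c t) else 0) = cnj u * c'"
    by (simp add: c'_def sum.If_cases Int_def sum_distrib_left)
  finally have nz: "(\<Sum>i | i \<in> I \<and> Z i = \<zeta> 1. C i) \<noteq> 0" using u(2) by simp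
  have "finite I" by (simp add: I_def)
  from exponential_sum_bounded_below[OF this \<zeta>(2) nz] obtain \<kappa> G where \<kappa>: "\<kappa> > 0"
    "\<And>n. \<exists>i<G. \<kappa> \<le> cmod (\<Sum>t\<in>I. C t * Z t ^ (n + i))" by blast
  have Re: "(\<Sum>t\<in>I. C t * Z t ^ n) = of_real (2 * Re (u * (\<Sum>t=1..T. c t * \<zeta> t ^ n)))" for n
  proof -
    have "(\<Sum>t\<in>I. C t * Z t ^ n) = u * (\<Sum>t=1..T. c t * \<zeta> t ^ n) + cnj (u * (\<Sum>t=1..T. c t * \<zeta> t ^ n))"
      unfolding split by (simp add: C_def Z_def sum.distrib sum_distrib_left mult.assoc)
    thus ?thesis unfolding complex_add_cnj .
  qed
  show thesis
  proof (rule that[of u "\<kappa> / 2" G])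
    show "cmod u = 1" using u(1) by auto
    show "\<kappa> / 2 > 0" using \<kappa> by simp
    fix n
    obtain i where i: "i < G" "\<kappa> \<le> cmod (\<Sum>t\<in>I. C t * Z t ^ (n + i))" using \<kappa>(2) by blast
    from i(2) have "\<kappa> / 2 \<le> \<bar>Re (u * (\<Sum>t=1..T. c t * \<zeta> t ^ (n + i)))\<bar>"
      unfolding Re norm_of_real by linarith
    with i(1) show "\<exists>i<G. \<kappa> / 2 \<le> \<bar>Re (u * (\<Sum>t=1..T. c t * \<zeta> t ^ (n + i)))\<bar>" by blast
  qed
qed

section \<open>From a sequence of forms to forms at every real scale\<close>

locale slowly_growing =
  fixes Q \<delta> :: "nat \<Rightarrow> real"
  assumes Q_pos: "\<And>n. Q n > 0" and Q_mono: "incseq Q"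
    and Q_lim: "filterlim Q at_top sequentially"
    and \<delta>: "\<delta> \<longlonglongrightarrow> 0" and Q_step: "\<And>n. Q (Suc n) = Q n powr (1 + \<delta> n)"
begin

lemma eventually_Q_ge: "\<forall>\<^sub>F n in sequentially. Q n \<ge> Y"
  using Q_lim by (simp add: filterlim_at_top)

text \<open>A fixed number of steps multiplies finitely many exponents tending to 1.\<close>

lemma eventually_Q_shift_le:
  assumes "e > 0"
  shows "\<forall>\<^sub>F n in sequentially. Q (n + G) \<le> Q n powr (1 + e)"
  using assms
proof (induction G arbitrary: e)
  case 0
  show ?case using eventually_Q_ge[of 1]
  proof eventually_elim
    case (elim n)
    have "Q n powr 1 \<le> Q n powr (1 + e)" using elim 0 by (intro powr_mono) auto
    thus ?case using elim by simp
  qed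
next
  case (Suc G)
  \<comment> \<open>Chosen so that (1 + e1)^2 = 1 + 2 e1 + e1^2 is at most 1 + 3 e1, hence at most 1
    + e.\<close>
  define e1 where "e1 = min 1 (e / 3)"
  have e1: "e1 > 0" "e1 \<le> 1" "3 * e1 \<le> e" using Suc.prems by (auto simp: e1_def)
  have "\<forall>\<^sub>F n in sequentially. \<delta> n < e1" using \<delta> e1(1) by (rule order_tendstoD)
  hence "\<forall>\<^sub>F n in sequentially. \<delta> (n + G) < e1" by (subst eventually_sequentially_seg)
  with Suc.IH[OF e1(1)] eventually_Q_ge[of 1] show ?case
  proof eventually_elim
    case (elim n)
    have ge: "Q (n + G) \<ge> 1" using elim(2) incseqD[OF Q_mono, of n "n + G"] by simp
    have "Q (n + Suc G) = Q (n + G) powr (1 + \<delta> (n + G))" by (simp add: Q_step)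
    also have "\<dots> \<le> Q (n + G) powr (1 + e1)" using elim(3) ge by (intro powr_mono) auto
    also have "\<dots> \<le> (Q n powr (1 + e1)) powr (1 + e1)" using elim ge e1 by (intro powr_mono2) auto
    also have "\<dots> = Q n powr ((1 + e1) * (1 + e1))" by (simp add: powr_powr)
    also have "\<dots> \<le> Q n powr (1 + e)"
    proof (rule powr_mono)
      have "e1 * e1 \<le> e1 * 1" using e1 by (intro mult_left_mono) auto
      moreover have "(1 + e1) * (1 + e1) = 1 + 2 * e1 + e1 * e1" by (simp add: algebra_simps)
      ultimately show "(1 + e1) * (1 + e1) \<le> 1 + e" using e1 by linarith
    qed (use elim in auto)
    finally show ?case .
  qed
qed

text \<open>Start at the first index with \<open>Q n \<ge> Y\<close>. Its predecessor still lies
  below \<open>Y\<close>, and the next index satisfying \<open>P\<close> is boundedly many steps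
  away, so slow growth keeps \<open>Q\<close> there below \<open>Y powr (1 + e)\<close>. Here
  \<open>P\<close> is a property that holds once in each window and \<open>R\<close> one that holds
  from some point on.\<close>

lemma eventually_index_in_window:
  assumes e: "e > 0" and P: "\<forall>\<^sub>F n in sequentially. \<exists>i<G. P (n + i)"
    and R: "\<forall>\<^sub>F n in sequentially. R n"
  shows "\<forall>\<^sub>F Y in at_top. \<exists>n. Y \<le> Q n \<and> Q n \<le> Y powr (1 + e) \<and> P n \<and> R n"
proof -
  from eventually_Q_shift_le[OF e, of "Suc G"] P R
  have "\<forall>\<^sub>F n in sequentially. Q (n + Suc G) \<le> Q n powr (1 + e) \<and> (\<exists>i<G. P (n + i)) \<and> R n"
    by eventually_elim auto
  then obtain N where N: "\<And>n. n \<ge> N \<Longrightarrow> Q (n + Suc G) \<le> Q n powr (1 + e) \<and> (\<exists>i<G. P (n + i)) \<and> R n"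
    unfolding eventually_sequentially by blast
  show ?thesis
    using eventually_gt_at_top[of "Q N"]
  proof eventually_elim
    case (elim Y)
    have "\<exists>n. Q n \<ge> Y" using eventually_Q_ge[of Y] unfolding eventually_sequentially by blast
    define n0 where "n0 = (LEAST n. Q n \<ge> Y)"
    have n0: "Q n0 \<ge> Y" unfolding n0_def using \<open>\<exists>n. Q n \<ge> Y\<close> by (rule LeastI_ex)
    have less: "Q n < Y" if "n < n0" for n using not_less_Least[of n "\<lambda>n. Q n \<ge> Y"] that by (simp add: n0_def)
    have "N < n0"
    proof (rule ccontr)
      assume "\<not> N < n0"
      hence "Q n0 \<le> Q N" using incseqD[OF Q_mono] by simp
      thus False using n0 elim by simp
    qed
    then obtain m where m: "n0 = Suc m" "m \<ge> N" by (cases n0) auto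
    obtain i where i: "i < G" "P (n0 + i)" using N[of n0] m by auto
    \<comment> \<open>The window is measured from the predecessor \<open>m\<close> of
      \<open>n0\<close>, hence one step longer than \<open>G\<close>.\<close>
    have "Q (n0 + i) \<le> Q (m + Suc G)" using i m by (intro incseqD[OF Q_mono]) auto
    also have "\<dots> \<le> Q m powr (1 + e)" using N[of m] m by simp
    also have "\<dots> \<le> Y powr (1 + e)" using less[of m] m e Q_pos[of m] by (intro powr_mono2) auto
    finally have "Q (n0 + i) \<le> Y powr (1 + e)" .
    moreover have "Y \<le> Q (n0 + i)" using n0 incseqD[OF Q_mono, of n0 "n0 + i"] by simp
    moreover have "R (n0 + i)" using N[of "n0 + i"] m by auto
    ultimately show ?case using i by blast
  qed
qed

text \<open>Only the lower bound is restricted to one index per window. Passing from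
  \<open>Q n\<close> to a nearby scale \<open>Y\<close> changes the exponents by a factor close to
  1, which is absorbed in \<open>e\<close>.\<close>

lemma card_ge_of_integer_forms_sequence:
  fixes x :: "nat \<Rightarrow> real" and m :: "nat \<Rightarrow> nat \<Rightarrow> int"
  assumes \<tau>: "\<tau> > 0"
    and size: "\<And>e. e > 0 \<Longrightarrow> \<forall>\<^sub>F n in sequentially. \<forall>s<M. \<bar>real_of_int (m s n)\<bar> \<le> Q n powr (1 + e)"
    and upper: "\<And>e. e > 0 \<Longrightarrow> \<forall>\<^sub>F n in sequentially. \<bar>\<Sum>s<M. m s n * x s\<bar> \<le> Q n powr (- \<tau> + e)"
    and lower: "\<And>e. e > 0 \<Longrightarrow> \<forall>\<^sub>F n in sequentially.
        \<exists>i<G. Q (n + i) powr (- \<tau> - e) \<le> \<bar>\<Sum>s<M. m s (n + i) * x s\<bar>"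
  shows "\<tau> + 1 \<le> real M"
proof (rule card_ge_of_small_integer_forms[OF \<tau>])
  fix e :: real assume e: "e > 0"
  \<comment> \<open>Three needs: (1 + e1)^2 is at most 1 + e; (1 + e1)(\<tau> + e1) is at most
    \<tau> + e; and -\<tau> + e1 is not positive, so that the upper bound decreases in its
    base.\<close>
  define e1 where "e1 = Min {1, \<tau>, e / (\<tau> + 3)}"
  have e1: "e1 > 0" "e1 \<le> 1" "e1 \<le> \<tau>" "e1 * (\<tau> + 3) \<le> e"
  proof -
    show "e1 > 0" "e1 \<le> 1" "e1 \<le> \<tau>" using e \<tau> by (auto simp: e1_def)
    have "e1 \<le> e / (\<tau> + 3)" by (simp add: e1_def)
    thus "e1 * (\<tau> + 3) \<le> e" using \<tau> by (simp add: pos_le_divide_eq)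
  qed
  have sq: "e1 * e1 \<le> e1" using e1 by (simp add: mult_left_le)
  have e\<tau>: "0 \<le> e1 * \<tau>" using e1 \<tau> by simp
  have "e1 * (\<tau> + 3) = e1 * \<tau> + 3 * e1" by (simp add: algebra_simps)
  hence e1e: "e1 * \<tau> + 3 * e1 \<le> e" using e1 by simp
  have "(1 + e1) * (1 + e1) = 1 + 2 * e1 + e1 * e1" by (simp add: algebra_simps)
  hence exp1: "(1 + e1) * (1 + e1) \<le> 1 + e" using e1e sq e\<tau> by linarith
  have "(1 + e1) * (- \<tau> - e1) = - \<tau> - e1 - e1 * \<tau> - e1 * e1" by (simp add: algebra_simps)
  hence exp2: "- \<tau> - e \<le> (1 + e1) * (- \<tau> - e1)" using e1e sq e1(1) by linarith
  have "\<forall>\<^sub>F n in sequentially. (\<forall>s<M. \<bar>real_of_int (m s n)\<bar> \<le> Q n powr (1 + e1)) \<and>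
      \<bar>\<Sum>s<M. m s n * x s\<bar> \<le> Q n powr (- \<tau> + e1)"
    using size[OF e1(1)] upper[OF e1(1)] by eventually_elim auto
  from eventually_index_in_window[OF e1(1) lower[OF e1(1)] this] eventually_ge_at_top[of "1::real"]
  show "\<forall>\<^sub>F Y in at_top. \<exists>m :: nat \<Rightarrow> int.
           (\<forall>s<M. \<bar>real_of_int (m s)\<bar> \<le> Y powr (1 + e)) \<and>
           Y powr (- \<tau> - e) \<le> \<bar>\<Sum>s<M. m s * x s\<bar> \<and>
           \<bar>\<Sum>s<M. m s * x s\<bar> \<le> Y powr (- \<tau> + e)"
  proof eventually_elim
    case (elim Y)
    then obtain n where n: "Y \<le> Q n" "Q n \<le> Y powr (1 + e1)"
      "Q n powr (- \<tau> - e1) \<le> \<bar>\<Sum>s<M. m s n * x s\<bar>"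
      "\<forall>s<M. \<bar>real_of_int (m s n)\<bar> \<le> Q n powr (1 + e1)"
      "\<bar>\<Sum>s<M. m s n * x s\<bar> \<le> Q n powr (- \<tau> + e1)" by blast
    have "Q n powr (1 + e1) \<le> Y powr (1 + e)"
    proof -
      have "Q n powr (1 + e1) \<le> (Y powr (1 + e1)) powr (1 + e1)"
        using n(2) e1 Q_pos[of n] by (intro powr_mono2) auto
      also have "\<dots> = Y powr ((1 + e1) * (1 + e1))" by (simp add: powr_powr)
      also have "\<dots> \<le> Y powr (1 + e)" using elim(2) exp1 by (intro powr_mono)
      finally show ?thesis .
    qed
    moreover have "Y powr (- \<tau> - e) \<le> Q n powr (- \<tau> - e1)"
    proof -
      have "Y powr (- \<tau> - e) \<le> Y powr ((1 + e1) * (- \<tau> - e1))"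
        using elim(2) exp2 by (intro powr_mono)
      also have "\<dots> = (Y powr (1 + e1)) powr (- \<tau> - e1)" by (simp add: powr_powr)
      also have "\<dots> \<le> Q n powr (- \<tau> - e1)"
        using n(2) e1 \<tau> Q_pos[of n] by (intro powr_mono2') auto
      finally show ?thesis .
    qed
    moreover have "Q n powr (- \<tau> + e1) \<le> Y powr (- \<tau> + e)"
    proof -
      have "Q n powr (- \<tau> + e1) \<le> Y powr (- \<tau> + e1)"
        using n(1) e1 elim(2) by (intro powr_mono2') auto
      also have "\<dots> \<le> Y powr (- \<tau> + e)"
        using elim(2) e1(1) e1e e\<tau> by (intro powr_mono) auto
      finally show ?thesis .
    qed
    ultimately show ?case using n(3-5) by (intro exI[of _ "\<lambda>s. m s n"]) (auto intro: order.trans)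
  qed
qed

end

section \<open>Algebraic integers\<close>

text \<open>The determinant trick: multiplication by \<open>x\<close> on the generators
  \<open>S\<close> is given by an integer matrix, so \<open>x\<close> is a root of its
  characteristic polynomial, which is monic with integer coefficients.\<close>

lemma algebraic_int_if_stable_lattice:
  fixes x :: complex
  assumes S: "finite S" "v0 \<in> S" "v0 \<noteq> 0"
    and stable: "\<And>v. v \<in> S \<Longrightarrow> \<exists>a :: complex \<Rightarrow> int. x * v = (\<Sum>w\<in>S. of_int (a w) * w)"
  shows "algebraic_int x"
proof -
  define n where "n = card S"
  obtain f where f: "bij_betw f {0..<n} S"
    using ex_bij_betw_nat_finite[OF S(1)] by (auto simp: n_def)
  obtain a :: "complex \<Rightarrow> complex \<Rightarrow> int"
    where a: "\<And>v. v \<in> S \<Longrightarrow> x * v = (\<Sum>w\<in>S. of_int (a v w) * w)"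
    using bchoice[of S "\<lambda>v a. x * v = (\<Sum>w\<in>S. of_int (a w) * w)"] stable by blast
  define A :: "int mat" where "A = mat n n (\<lambda>(i, j). a (f i) (f j))"
  define A' :: "complex mat" where "A' = map_mat of_int A"
  have A: "A \<in> carrier_mat n n" and A': "A' \<in> carrier_mat n n" by (auto simp: A_def A'_def)
  have fS: "f i \<in> S" if "i < n" for i using f that by (auto simp: bij_betw_def)
  have row: "x * f i = (\<Sum>j=0..<n. of_int (a (f i) (f j)) * f j)" if "i < n" for i
    using a[OF fS[OF that]] sum.reindex_bij_betw[OF f, of "\<lambda>w. of_int (a (f i) w) * w"] by simp
  \<comment> \<open>The generators themselves form the eigenvector; it is non-zero because of
    \<open>v0\<close>.\<close>
  have "eigenvector A' (vec n f) x"
    unfolding eigenvector_def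
  proof (intro conjI)
    show "vec n f \<in> carrier_vec (dim_row A')" using A' by auto
    obtain i where i: "i < n" "f i = v0" using f S(2) by (force simp: bij_betw_def)
    have "vec n f $ i \<noteq> 0\<^sub>v n $ i" using i S(3) by simp
    thus "vec n f \<noteq> 0\<^sub>v (dim_row A')" using A' by auto
    show "A' *\<^sub>v vec n f = x \<cdot>\<^sub>v vec n f"
    proof (rule eq_vecI)
      fix i assume "i < dim_vec (x \<cdot>\<^sub>v vec n f)"
      hence i: "i < n" by simp
      thus "(A' *\<^sub>v vec n f) $ i = (x \<cdot>\<^sub>v vec n f) $ i"
        using row[OF i] by (simp add: A'_def A_def scalar_prod_def)
    qed (use A' in auto)
  qed
  hence "poly (char_poly A') x = 0"
    using eigenvalue_root_char_poly[OF A'] by (auto simp: eigenvalue_def)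
  hence "poly (map_poly of_int (char_poly A)) x = 0"
    unfolding A'_def of_int_hom.char_poly_hom[OF A] .
  moreover have "lead_coeff (char_poly A) = 1"
    using degree_monic_char_poly[OF A] by simp
  ultimately show ?thesis unfolding algebraic_int_altdef_ipoly by blast
qed

interpretation int_module: Modules.module "\<lambda>(a::int) (z::complex). of_int a * z"
  by unfold_locales (auto simp: algebra_simps)

lemma algebraic_int_if_stable_int_span:
  fixes x :: complex
  assumes S: "finite S" "1 \<in> S" and stable: "\<And>v. v \<in> S \<Longrightarrow> x * v \<in> int_module.span S"
  shows "algebraic_int x"
proof (rule algebraic_int_if_stable_lattice[OF S])
  fix v assume "v \<in> S"
  from stable[OF this] show "\<exists>a :: complex \<Rightarrow> int. x * v = (\<Sum>w\<in>S. of_int (a w) * w)"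
    unfolding int_module.span_finite[OF S(1)] by auto
qed simp

lemma algebraic_int_power_relation:
  fixes x :: complex
  assumes "algebraic_int x"
  obtains n :: nat and c :: "nat \<Rightarrow> int" where "n > 0" "x ^ n = (\<Sum>i<n. of_int (c i) * x ^ i)"
proof -
  obtain p :: "int poly" where p: "poly (map_poly of_int p) x = 0" "lead_coeff p = 1"
    using assms unfolding algebraic_int_altdef_ipoly by blast
  define n where "n = degree p"
  have deg: "degree (map_poly of_int p :: complex poly) = n"
    by (simp add: n_def)
  have "(\<Sum>i\<le>n. of_int (coeff p i) * x ^ i) = 0"
    using p(1) unfolding poly_altdef deg by simp
  hence "x ^ n = - (\<Sum>i<n. of_int (coeff p i) * x ^ i)"
    using p(2) by (simp add: n_def lessThan_Suc_atMost[symmetric] add_eq_0_iff)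
  hence "x ^ n = (\<Sum>i<n. of_int (- coeff p i) * x ^ i)"
    by (simp add: sum_negf)
  note rel = this
  have "n > 0" using rel by (intro Nat.gr0I) simp
  from this rel show thesis by (rule that)
qed

text \<open>The products of small powers of \<open>x\<close> and \<open>y\<close> generate it: a
  power that leaves the range is reduced by the monic relation. One lattice stable under both
  numbers is also stable under their sum and product, which gives closure of the algebraic
  integers.\<close>

lemma algebraic_int_common_lattice:
  fixes x y :: complex
  assumes "algebraic_int x" "algebraic_int y"
  obtains S where "finite S" "1 \<in> S"
    "\<And>v. v \<in> int_module.span S \<Longrightarrow> x * v \<in> int_module.span S"
    "\<And>v. v \<in> int_module.span S \<Longrightarrow> y * v \<in> int_module.span S"
proof -
  obtain m c where m: "m > 0" "x ^ m = (\<Sum>i<m. of_int (c i) * x ^ i)"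
    using algebraic_int_power_relation[OF assms(1)] by metis
  obtain n d where n: "n > 0" "y ^ n = (\<Sum>i<n. of_int (d i) * y ^ i)"
    using algebraic_int_power_relation[OF assms(2)] by metis
  define S where "S = (\<lambda>(i, j). x ^ i * y ^ j) ` ({..<m} \<times> {..<n})"
  have S: "x ^ i * y ^ j \<in> S" if "i < m" "j < n" for i j using that by (auto simp: S_def)
  have lin: "z * v \<in> int_module.span S"
    if *: "\<And>v. v \<in> S \<Longrightarrow> z * v \<in> int_module.span S" and v: "v \<in> int_module.span S" for z v
    using v
  proof (induction rule: int_module.span_induct_alt)
    case base
    thus ?case by (simp add: int_module.span_zero)
  next
    case (step a u w)
    have "of_int a * (z * u) + z * w \<in> int_module.span S"
      using step * by (intro int_module.span_add int_module.span_scale) auto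
    thus ?case by (simp add: algebra_simps)
  qed
  have base: "x ^ i * y ^ j \<in> int_module.span S" if "i < m" "j < n" for i j
    using S[OF that] by (rule int_module.span_base)
  have x: "x * v \<in> int_module.span S" if vS: "v \<in> S" for v
  proof -
    obtain i j where ij: "i < m" "j < n" "v = x ^ i * y ^ j" using vS by (auto simp: S_def)
    show ?thesis
    proof (cases "Suc i < m")
      case True
      thus ?thesis using base[OF True ij(2)] by (simp add: ij mult_ac)
    next
      case False
      hence "Suc i = m" using ij by simp
      hence "x * v = x ^ m * y ^ j" by (auto simp: ij)
      also have "\<dots> = (\<Sum>k<m. of_int (c k) * (x ^ k * y ^ j))"
        unfolding m(2) by (subst sum_distrib_right) (simp add: mult_ac)
      also have "\<dots> \<in> int_module.span S"
        using ij base by (intro int_module.span_sum int_module.span_scale) auto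
      finally show ?thesis .
    qed
  qed
  have y: "y * v \<in> int_module.span S" if vS: "v \<in> S" for v
  proof -
    obtain i j where ij: "i < m" "j < n" "v = x ^ i * y ^ j" using vS by (auto simp: S_def)
    show ?thesis
    proof (cases "Suc j < n")
      case True
      thus ?thesis using base[OF ij(1) True] by (simp add: ij mult_ac)
    next
      case False
      hence "Suc j = n" using ij by simp
      hence "y * v = x ^ i * y ^ n" by (auto simp: ij)
      also have "\<dots> = (\<Sum>k<n. of_int (d k) * (x ^ i * y ^ k))"
        unfolding n(2) by (subst sum_distrib_left) (simp add: mult_ac)
      also have "\<dots> \<in> int_module.span S"
        using ij base by (intro int_module.span_sum int_module.span_scale) auto
      finally show ?thesis .
    qed
  qed
  show thesis
  proof (rule that)
    show "finite S" by (simp add: S_def)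
    show "1 \<in> S" using S[of 0 0] m(1) n(1) by simp
  qed (use lin x y in blast)+
qed

lemma algebraic_int_add_mult:
  fixes x y :: complex
  assumes "algebraic_int x" "algebraic_int y"
  shows algebraic_int_add: "algebraic_int (x + y)" and algebraic_int_mult: "algebraic_int (x * y)"
proof -
  obtain S where S: "finite S" "1 \<in> S"
    "\<And>v. v \<in> int_module.span S \<Longrightarrow> x * v \<in> int_module.span S"
    "\<And>v. v \<in> int_module.span S \<Longrightarrow> y * v \<in> int_module.span S"
    using algebraic_int_common_lattice[OF assms] by blast
  show "algebraic_int (x + y)" using S
    by (intro algebraic_int_if_stable_int_span[OF S(1,2)])
       (auto simp: distrib_right intro: int_module.span_add int_module.span_base)
  show "algebraic_int (x * y)" using S
    by (intro algebraic_int_if_stable_int_span[OF S(1,2)])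
       (auto simp: mult.assoc intro: int_module.span_base)
qed

text \<open>Multiplying the equation of \<open>x\<close> by the power \<open>n - 1\<close> of the
  leading coefficient \<open>a\<close> turns it into a monic integer equation for
  \<open>a * x\<close>; hence the powers of \<open>a * x\<close> below \<open>n\<close> span a
  stable lattice.\<close>

lemma algebraic_int_lead_coeff_mult:
  fixes x :: complex and p :: "int poly"
  assumes "poly (map_poly of_int p) x = 0" "p \<noteq> 0"
  shows "algebraic_int (of_int (lead_coeff p) * x)"
proof -
  define n a where "n = degree p" and "a = lead_coeff p"
  define c where "c = (\<lambda>i. coeff p i * a ^ (n - 1 - i))"
  define y where "y = of_int a * x"
  have deg: "degree (map_poly of_int p :: complex poly) = n"
    by (simp add: n_def)
  have rel: "(\<Sum>i\<le>n. of_int (coeff p i) * x ^ i) = 0"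
    using assms(1) unfolding poly_altdef deg by simp
  have "n \<noteq> 0"
  proof
    assume "n = 0"
    with rel have "lead_coeff p = 0" by (simp add: n_def)
    with assms(2) show False by simp
  qed
  have *: "of_int (c i) * y ^ i = of_int (a ^ (n - 1)) * (of_int (coeff p i) * x ^ i)" if "i < n" for i
  proof -
    have "a ^ (n - 1) = a ^ (n - 1 - i) * a ^ i" using that by (simp flip: power_add)
    thus ?thesis by (simp add: c_def y_def power_mult_distrib)
  qed
  have "y ^ n = of_int (a ^ (n - 1)) * (of_int (coeff p n) * x ^ n)"
    using \<open>n \<noteq> 0\<close> by (cases n) (simp_all add: y_def power_mult_distrib a_def n_def)
  also have "of_int (coeff p n) * x ^ n = - (\<Sum>i<n. of_int (coeff p i) * x ^ i)"
    using rel by (simp add: lessThan_Suc_atMost[symmetric] add_eq_0_iff)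
  finally have yn: "y ^ n = - (\<Sum>i<n. of_int (c i) * y ^ i)"
    using * by (simp add: sum_distrib_left)
  define S where "S = (\<lambda>i. y ^ i) ` {..<n}"
  show ?thesis unfolding a_def[symmetric] y_def[symmetric]
  proof (rule algebraic_int_if_stable_int_span)
    show "finite S" by (simp add: S_def)
    show "1 \<in> S" using \<open>n \<noteq> 0\<close> by (force simp: S_def intro: image_eqI[of _ _ 0])
    fix v assume "v \<in> S"
    then obtain i where i: "i < n" "v = y ^ i" by (auto simp: S_def)
    show "y * v \<in> int_module.span S"
    proof (cases "Suc i < n")
      case True
      thus ?thesis by (auto simp: S_def i intro!: int_module.span_base image_eqI[of _ _ "Suc i"])
    next
      case False
      hence "y * v = - (\<Sum>k<n. of_int (c k) * y ^ k)"
        using i yn by (metis Suc_lessI power_Suc)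
      also have "\<dots> \<in> int_module.span S" unfolding S_def
        by (intro int_module.span_neg int_module.span_sum int_module.span_scale int_module.span_base) auto
      finally show ?thesis .
    qed
  qed
qed

text \<open>One direction clears the leading coefficient, the other substitutes \<open>D\<close>
  times the variable in the polynomial. Closure properties of algebraic numbers thereby reduce to
  those of algebraic integers.\<close>

lemma algebraic_iff_multiple_algebraic_int:
  fixes x :: complex
  shows "algebraic x \<longleftrightarrow> (\<exists>D::nat. D > 0 \<and> algebraic_int (of_nat D * x))"
proof
  assume "algebraic x"
  then obtain p :: "int poly" where p: "p \<noteq> 0" "poly (map_poly of_int p) x = 0"
    by (rule algebraicE')
  define a where "a = lead_coeff p"
  have a: "a \<noteq> 0" "algebraic_int (of_int a * x)"
    using algebraic_int_lead_coeff_mult[OF p(2,1)] p by (auto simp: a_def)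
  \<comment> \<open>The sign turns the integer multiplier into a positive natural number.\<close>
  have "algebraic_int (of_int (sgn a) * (of_int a * x))"
    by (rule algebraic_int_mult[OF int_imp_algebraic_int a(2)]) auto
  also have "of_int (sgn a) * (of_int a * x) = of_nat (nat \<bar>a\<bar>) * x"
    by (simp add: mult_sgn_abs sgn_if)
  finally show "\<exists>D::nat. D > 0 \<and> algebraic_int (of_nat D * x)"
    using a(1) by (intro exI[of _ "nat \<bar>a\<bar>"]) auto
next
  assume "\<exists>D::nat. D > 0 \<and> algebraic_int (of_nat D * x)"
  then obtain D :: nat where D: "D > 0" "algebraic (of_nat D * x)" by blast
  obtain p where p: "\<And>i. coeff p i \<in> \<int>" "p \<noteq> 0" "poly p (of_nat D * x) = 0"
    using D(2) by (auto simp: algebraic_def)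
  show "algebraic x"
  proof (rule algebraicI)
    show "coeff (pcompose p [:0, of_nat D:]) i \<in> \<int>" for i
      using p(1) by (simp add: coeff_pcompose_linear)
    show "pcompose p [:0, of_nat D:] \<noteq> 0"
      using p(2) D(1) by (simp add: pcompose_eq_0_iff)
    show "poly (pcompose p [:0, of_nat D:]) x = 0"
      using p(3) by (simp add: poly_pcompose mult.commute)
  qed
qed

lemma algebraic_add_mult:
  fixes x y :: complex
  assumes "algebraic x" "algebraic y"
  shows algebraic_add: "algebraic (x + y)" and algebraic_mult: "algebraic (x * y)"
proof -
  obtain D E :: nat where D: "D > 0" "algebraic_int (of_nat D * x)" and E: "E > 0" "algebraic_int (of_nat E * y)"
    using assms unfolding algebraic_iff_multiple_algebraic_int by blast
  have "algebraic_int (of_nat E * (of_nat D * x) + of_nat D * (of_nat E * y))"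
    by (intro algebraic_int_add algebraic_int_mult D E) auto
  also have "of_nat E * (of_nat D * x) + of_nat D * (of_nat E * y) = of_nat (D * E) * (x + y)"
    by (simp add: algebra_simps)
  finally show "algebraic (x + y)"
    unfolding algebraic_iff_multiple_algebraic_int using D(1) E(1) by (intro exI[of _ "D * E"]) simp
  have "algebraic_int ((of_nat D * x) * (of_nat E * y))"
    by (intro algebraic_int_mult D E)
  also have "(of_nat D * x) * (of_nat E * y) = of_nat (D * E) * (x * y)"
    by (simp add: algebra_simps)
  finally show "algebraic (x * y)"
    unfolding algebraic_iff_multiple_algebraic_int using D(1) E(1) by (intro exI[of _ "D * E"]) simp
qed

section \<open>Rational functionals on a number field\<close>

lemma map_poly_of_rat_mult:
  "map_poly of_rat (p * q) = (map_poly of_rat p * map_poly of_rat q :: 'a :: field_char_0 poly)"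
  by (rule poly_eqI) (simp add: coeff_map_poly coeff_mult of_rat_sum of_rat_mult)

lemma map_poly_of_rat_add:
  "map_poly of_rat (p + q) = (map_poly of_rat p + map_poly of_rat q :: 'a :: field_char_0 poly)"
  by (rule poly_eqI) (simp add: coeff_map_poly of_rat_add)

lemma map_poly_of_rat_pderiv:
  "map_poly of_rat (pderiv p) = (pderiv (map_poly of_rat p) :: 'a :: field_char_0 poly)"
  by (rule poly_eqI) (simp add: coeff_map_poly coeff_pderiv of_rat_mult of_rat_add)

text \<open>Take a non-zero rational polynomial of least degree vanishing at \<open>a\<close> and
  make it monic. In a factorisation some factor vanishes at \<open>a\<close> and so has full degree,
  leaving a constant cofactor.\<close>

lemma algebraic_imp_root_of_monic_irreducible:
  fixes a :: complex
  assumes "algebraic a"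
  obtains q :: "rat poly" where "lead_coeff q = 1" "Factorial_Ring.irreducible q"
    "poly (map_poly of_rat q) a = 0"
proof -
  define R where "R = (\<lambda>q :: rat poly. q \<noteq> 0 \<and> poly (map_poly of_rat q) a = 0)"
  obtain p :: "int poly" where p: "p \<noteq> 0" "poly (map_poly of_int p) a = 0"
    using assms by (rule algebraicE')
  have "(map_poly of_int p :: complex poly) = map_poly of_rat (map_poly of_int p)"
    by (simp add: map_poly_map_poly o_def)
  hence "R (map_poly of_int p)" using p by (simp add: R_def)
  then obtain q where q: "R q" and min: "\<And>q'. R q' \<Longrightarrow> degree q \<le> degree q'"
    using exists_least_iff[of "\<lambda>n. \<exists>q. R q \<and> degree q = n"] by (metis not_le_imp_less)
  define m where "m = smult (inverse (lead_coeff q)) q"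
  have q0: "q \<noteq> 0" using q by (simp add: R_def)
  have Rm: "R m" "degree m = degree q" using q q0 by (auto simp: m_def R_def of_rat_hom.map_poly_hom_smult)
  have "Factorial_Ring.irreducible m"
  proof (rule irreducibleI)
    show "m \<noteq> 0" using Rm by (simp add: R_def)
    show "\<not> is_unit m"
    proof
      assume "is_unit m"
      hence "degree m = 0" using \<open>m \<noteq> 0\<close> by (simp add: is_unit_iff_degree)
      then obtain c where "m = [:c:]" by (rule degree_eq_zeroE)
      thus False using Rm by (auto simp: R_def)
    qed
    fix b c assume bc: "m = b * c"
    hence nz: "b \<noteq> 0" "c \<noteq> 0" using Rm by (auto simp: R_def)
    have deg: "degree m = degree b + degree c" using bc nz by (simp add: degree_mult_eq)
    have "poly (map_poly of_rat b) a * poly (map_poly of_rat c) a = 0"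
      using Rm bc by (simp add: R_def map_poly_of_rat_mult)
    hence "R b \<or> R c" using nz by (auto simp: R_def)
    hence "degree b = 0 \<or> degree c = 0" using min[of b] min[of c] deg Rm by auto
    thus "is_unit b \<or> is_unit c" using nz by (auto simp: is_unit_iff_degree)
  qed
  moreover have "lead_coeff m = 1" using q0 by (simp add: m_def)
  ultimately show thesis using that[of m] Rm by (simp add: R_def)
qed

text \<open>Separability in characteristic 0: \<open>q\<close> is coprime to its derivative, and the
  Bezout identity, read over the complex numbers, excludes a common root. Hence all complex roots
  are simple.\<close>

lemma irreducible_rat_poly_splits:
  fixes q :: "rat poly"
  assumes "Factorial_Ring.irreducible q" "lead_coeff q = 1"
  shows "(\<Prod>z | poly (map_poly of_rat q) z = 0. [:- z, 1:]) = (map_poly of_rat q :: complex poly)"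
proof -
  have "degree q \<noteq> 0"
    using assms(1) by (auto simp: Factorial_Ring.irreducible_def is_unit_iff_degree)
  hence "\<not> q dvd pderiv q"
    using dvd_imp_degree_le[of q "pderiv q"] by (auto simp: pderiv_eq_0_iff degree_pderiv)
  hence "coprime q (pderiv q)"
    using assms(1) by (intro prime_elem_imp_coprime irreducible_imp_prime_elem) auto
  hence "fst (bezout_coefficients q (pderiv q)) * q + snd (bezout_coefficients q (pderiv q)) * pderiv q = 1"
    by (simp add: bezout_coefficients_fst_snd)
  then obtain u v where "u * q + v * pderiv q = 1" by blast
  hence "map_poly of_rat (u * q + v * pderiv q) = (1 :: complex poly)" by simp
  hence bez: "map_poly of_rat u * map_poly of_rat q + map_poly of_rat v * pderiv (map_poly of_rat q) = (1 :: complex poly)"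
    by (simp add: map_poly_of_rat_add map_poly_of_rat_mult map_poly_of_rat_pderiv)
  have "rsquarefree (map_poly of_rat q :: complex poly)"
    unfolding rsquarefree_roots
  proof safe
    fix z :: complex
    assume "poly (map_poly of_rat q) z = 0" "poly (pderiv (map_poly of_rat q)) z = 0"
    thus False using arg_cong[OF bez, of "\<lambda>f. poly f z"] by simp
  qed
  from complex_poly_decompose_rsquarefree[OF this] show ?thesis using assms(2) by simp
qed

locale rat_subalgebra =
  fixes K :: "complex set"
  assumes rat_subset: "\<rat> \<subseteq> K"
    and add_closed: "x \<in> K \<Longrightarrow> y \<in> K \<Longrightarrow> x + y \<in> K"
    and mult_closed: "x \<in> K \<Longrightarrow> y \<in> K \<Longrightarrow> x * y \<in> K"
begin

lemma zero_closed: "0 \<in> K" and one_closed: "1 \<in> K"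
  using rat_subset by auto

lemma power_closed: "x \<in> K \<Longrightarrow> x ^ n \<in> K"
  by (induction n) (auto simp: one_closed mult_closed)

definition functional :: "(complex \<Rightarrow> complex) \<Rightarrow> bool" where
  "functional \<phi> \<longleftrightarrow> (\<forall>x\<in>K. \<forall>y\<in>K. \<phi> (x + y) = \<phi> x + \<phi> y) \<and>
     (\<forall>r\<in>\<rat>. \<forall>x\<in>K. \<phi> (r * x) = r * \<phi> x) \<and> (\<forall>x\<in>K. algebraic (\<phi> x))"

lemma functional_0: "functional \<phi> \<Longrightarrow> \<phi> 0 = 0"
  using zero_closed unfolding functional_def by (metis Rats_0 mult_zero_left)

lemma functional_sum:
  assumes "functional \<phi>" "finite I" "\<And>i. i \<in> I \<Longrightarrow> f i \<in> K"
  shows "\<phi> (\<Sum>i\<in>I. f i) = (\<Sum>i\<in>I. \<phi> (f i))"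
proof -
  have "\<phi> (\<Sum>i\<in>I. f i) = (\<Sum>i\<in>I. \<phi> (f i)) \<and> (\<Sum>i\<in>I. f i) \<in> K"
    using assms(2,3)
    by (induction I) (use assms(1) in \<open>auto simp: functional_0 functional_def zero_closed add_closed\<close>)
  thus ?thesis ..
qed

lemma functional_poly:
  assumes "functional \<phi>" "\<And>i. coeff f i \<in> \<rat>" "a \<in> K" "x \<in> K"
  shows "\<phi> (poly f a * x) = (\<Sum>i\<le>degree f. coeff f i * \<phi> (a ^ i * x))"
proof -
  have "\<phi> (poly f a * x) = \<phi> (\<Sum>i\<le>degree f. coeff f i * (a ^ i * x))"
    by (simp add: poly_altdef sum_distrib_right mult.assoc)
  also have "\<dots> = (\<Sum>i\<le>degree f. \<phi> (coeff f i * (a ^ i * x)))"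
    using assms rat_subset by (intro functional_sum) (auto intro!: mult_closed power_closed)
  also have "\<dots> = (\<Sum>i\<le>degree f. coeff f i * \<phi> (a ^ i * x))"
    using assms by (intro sum.cong) (auto simp: functional_def intro!: mult_closed power_closed)
  finally show ?thesis .
qed

end

section \<open>Splitting functionals into common eigenvectors of multiplications\<close>

text \<open>This is \<open>g(A) \<phi>\<close> evaluated at \<open>x\<close>, for the operator
  \<open>A\<close> that sends \<phi> to \<open>\<lambda>x. \<phi> (a * x)\<close>.\<close>

definition shift_act :: "complex \<Rightarrow> (complex \<Rightarrow> complex) \<Rightarrow> complex poly \<Rightarrow> complex \<Rightarrow> complex" where
  "shift_act a \<phi> g x = (\<Sum>i\<le>degree g. coeff g i * \<phi> (a ^ i * x))"

text \<open>Polynomials in one operator multiply by composition, so a linear factor can be moved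
  onto \<phi>. This lets the roots be removed one at a time.\<close>

lemma shift_act_mult_linear:
  "shift_act a \<phi> ([:- r, 1:] * g) x = shift_act a (\<lambda>x. \<phi> (a * x) - r * \<phi> x) g x"
proof -
  define n where "n = degree g"
  have bound: "shift_act a \<phi> f x = (\<Sum>i\<le>m. coeff f i * \<phi> (a ^ i * x))" if "degree f \<le> m" for f m
    unfolding shift_act_def using that
    by (intro sum.mono_neutral_left) (auto simp: coeff_eq_0)
  have eq: "[:- r, 1:] * g = pCons 0 g - smult r g" by simp
  have "degree (pCons 0 g - smult r g) \<le> Suc n"
    by (rule degree_diff_le) (auto simp: n_def degree_pCons_eq_if intro: order.trans[OF degree_smult_le])
  hence "shift_act a \<phi> ([:- r, 1:] * g) x =
      (\<Sum>i\<le>Suc n. coeff (pCons 0 g - smult r g) i * \<phi> (a ^ i * x))"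
    unfolding eq by (rule bound)
  also have "\<dots> = (\<Sum>i\<le>Suc n. coeff (pCons 0 g) i * \<phi> (a ^ i * x)) -
      (\<Sum>i\<le>Suc n. r * coeff g i * \<phi> (a ^ i * x))"
    by (simp only: coeff_diff coeff_smult left_diff_distrib sum_subtractf)
  also have "(\<Sum>i\<le>Suc n. coeff (pCons 0 g) i * \<phi> (a ^ i * x)) = (\<Sum>i\<le>n. coeff g i * \<phi> (a ^ Suc i * x))"
    by (subst sum.atMost_Suc_shift) simp
  also have "(\<Sum>i\<le>Suc n. r * coeff g i * \<phi> (a ^ i * x)) = (\<Sum>i\<le>n. r * coeff g i * \<phi> (a ^ i * x))"
    by (simp add: n_def coeff_eq_0)
  also have "(\<Sum>i\<le>n. coeff g i * \<phi> (a ^ Suc i * x)) - \<dots> =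
      (\<Sum>i\<le>n. coeff g i * (\<phi> (a * (a ^ i * x)) - r * \<phi> (a ^ i * x)))"
    by (simp add: sum_subtractf[symmetric] algebra_simps)
  finally show ?thesis by (simp add: shift_act_def n_def)
qed

text \<open>An operator annihilated by a polynomial with simple roots is diagonalisable: if
  \<open>(A - \<beta>) \<phi> = \<Sum>\<^sub>r \<psi>\<^sub>r\<close> with \<open>A \<psi>\<^sub>r = r \<psi>\<^sub>r\<close>, then \<open>\<phi> - \<Sum>\<^sub>r \<psi>\<^sub>r / (r - \<beta>)\<close> is an
  eigenvector for \<open>\<beta>\<close>.\<close>

lemma eigenvector_decomposition:
  fixes W :: "(complex \<Rightarrow> complex) set"
  assumes "finite R" "\<And>r. r \<in> R \<Longrightarrow> algebraic r"
    and W_add: "\<And>\<phi> \<psi>. \<phi> \<in> W \<Longrightarrow> \<psi> \<in> W \<Longrightarrow> (\<lambda>x. \<phi> x + \<psi> x) \<in> W"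
    and W_scale: "\<And>c \<phi>. algebraic c \<Longrightarrow> \<phi> \<in> W \<Longrightarrow> (\<lambda>x. c * \<phi> x) \<in> W"
    and W_shift: "\<And>\<phi>. \<phi> \<in> W \<Longrightarrow> (\<lambda>x. \<phi> (a * x)) \<in> W"
    and "\<phi> \<in> W" "\<And>x. x \<in> K \<Longrightarrow> shift_act a \<phi> (\<Prod>r\<in>R. [:- r, 1:]) x = 0"
  shows "\<exists>\<psi>. (\<forall>r\<in>R. \<psi> r \<in> W \<and> (\<forall>x\<in>K. \<psi> r (a * x) = r * \<psi> r x)) \<and>
             (\<forall>x\<in>K. \<phi> x = (\<Sum>r\<in>R. \<psi> r x))"
  using assms(1,2,6,7)
proof (induction R arbitrary: \<phi>)
  case empty
  thus ?case by (simp add: shift_act_def)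
next
  case (insert \<beta> R)
  define \<phi>1 where "\<phi>1 = (\<lambda>x. \<phi> (a * x) - \<beta> * \<phi> x)"
  have alg\<beta>: "algebraic \<beta>" using insert.prems by simp
  have "(\<lambda>x. \<phi> (a * x) + (- \<beta>) * \<phi> x) \<in> W"
    using insert.prems alg\<beta> by (intro W_add W_scale W_shift) auto
  hence "\<phi>1 \<in> W" by (simp add: \<phi>1_def)
  moreover have "shift_act a \<phi>1 (\<Prod>r\<in>R. [:- r, 1:]) x = 0" if "x \<in> K" for x
    using insert.prems(3)[OF that] insert.hyps
    unfolding prod.insert[OF insert.hyps] shift_act_mult_linear \<phi>1_def by simp
  ultimately have "\<exists>\<psi>. (\<forall>r\<in>R. \<psi> r \<in> W \<and> (\<forall>x\<in>K. \<psi> r (a * x) = r * \<psi> r x)) \<and>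
             (\<forall>x\<in>K. \<phi>1 x = (\<Sum>r\<in>R. \<psi> r x))"
    using insert.prems(1) by (intro insert.IH) auto
  then obtain \<psi> where \<psi>: "\<And>r. r \<in> R \<Longrightarrow> \<psi> r \<in> W"
      "\<And>r x. r \<in> R \<Longrightarrow> x \<in> K \<Longrightarrow> \<psi> r (a * x) = r * \<psi> r x"
      "\<And>x. x \<in> K \<Longrightarrow> \<phi>1 x = (\<Sum>r\<in>R. \<psi> r x)"
    by blast
  define c where "c = (\<lambda>r. inverse (r - \<beta>))"
  have c: "c r * (r - \<beta>) = 1" if "r \<in> R" for r
  proof -
    have "r \<noteq> \<beta>" using that insert.hyps by auto
    thus ?thesis by (simp add: c_def)
  qed
  have c_alg: "algebraic (c r)" if "r \<in> R" for r
    using algebraic_add[of r "- \<beta>"] alg\<beta> insert.prems(1)[of r] that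
    by (auto simp: c_def intro!: algebraic_inverse)
  define \<psi>0 where "\<psi>0 = (\<lambda>x. \<phi> x - (\<Sum>r\<in>R. c r * \<psi> r x))"
  \<comment> \<open>The induction runs over subsets \<open>R'\<close>, since the facts about \<psi>
    refer to the fixed set \<open>R\<close>. The empty sum lies in \<open>W\<close> as 0 times
    \<phi>.\<close>
  have "(\<lambda>x. \<Sum>r\<in>R'. (- c r) * \<psi> r x) \<in> W" if "R' \<subseteq> R" for R'
    using finite_subset[OF that insert.hyps(1)] that
  proof (induction R')
    case empty
    thus ?case using W_scale[OF algebraic_0 insert.prems(2)] by simp
  next
    case (insert r R')
    have "(\<lambda>x. (- c r) * \<psi> r x + (\<Sum>r\<in>R'. (- c r) * \<psi> r x)) \<in> W"
      using insert \<psi>(1) c_alg by (intro W_add W_scale) auto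
    thus ?case unfolding sum.insert[OF insert.hyps] .
  qed
  hence "(\<lambda>x. \<phi> x + (\<Sum>r\<in>R. (- c r) * \<psi> r x)) \<in> W"
    using insert.prems(2) by (intro W_add) auto
  hence \<psi>0W: "\<psi>0 \<in> W" by (simp add: \<psi>0_def sum_negf)
  have \<psi>0: "\<psi>0 (a * x) = \<beta> * \<psi>0 x" if x: "x \<in> K" for x
  proof -
    have "\<psi>0 (a * x) - \<beta> * \<psi>0 x = \<phi>1 x - (\<Sum>r\<in>R. c r * \<psi> r (a * x) - \<beta> * (c r * \<psi> r x))"
      by (simp add: \<psi>0_def \<phi>1_def sum_subtractf sum_distrib_left algebra_simps)
    also have "(\<Sum>r\<in>R. c r * \<psi> r (a * x) - \<beta> * (c r * \<psi> r x)) = (\<Sum>r\<in>R. \<psi> r x)"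
    proof (rule sum.cong)
      fix r assume r: "r \<in> R"
      have "c r * \<psi> r (a * x) - \<beta> * (c r * \<psi> r x) = (c r * (r - \<beta>)) * \<psi> r x"
        unfolding \<psi>(2)[OF r x] by (simp add: algebra_simps)
      thus "c r * \<psi> r (a * x) - \<beta> * (c r * \<psi> r x) = \<psi> r x" using c[OF r] by simp
    qed simp
    finally show ?thesis using \<psi>(3)[OF x] by simp
  qed
  define \<psi>' where "\<psi>' = (\<lambda>r. if r = \<beta> then \<psi>0 else (\<lambda>x. c r * \<psi> r x))"
  have ne: "r \<noteq> \<beta>" if "r \<in> R" for r using that insert.hyps by auto
  show ?case
  proof (intro exI[of _ \<psi>'] conjI ballI)
    fix r assume "r \<in> insert \<beta> R"
    thus "\<psi>' r \<in> W" using \<psi>0W \<psi>(1) c_alg W_scale by (auto simp: \<psi>'_def)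
    fix x assume x: "x \<in> K"
    show "\<psi>' r (a * x) = r * \<psi>' r x"
      using \<open>r \<in> insert \<beta> R\<close> \<psi>0[OF x] \<psi>(2)[OF _ x] ne by (auto simp: \<psi>'_def)
  next
    fix x assume "x \<in> K"
    have "(\<Sum>r\<in>R. \<psi>' r x) = (\<Sum>r\<in>R. c r * \<psi> r x)"
      using ne by (intro sum.cong) (auto simp: \<psi>'_def)
    thus "\<phi> x = (\<Sum>r\<in>insert \<beta> R. \<psi>' r x)"
      unfolding sum.insert[OF insert.hyps] by (simp add: \<psi>'_def \<psi>0_def)
  qed
qed

context rat_subalgebra
begin

text \<open>Finite sums of functionals that are eigenvectors for multiplication by every element of
  \<open>bs\<close>, with eigenvalues depending on the summand. The inductive form lets denominators
  and bounds be passed through the sum termwise.\<close>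

inductive eigen_sum :: "complex set \<Rightarrow> (complex \<Rightarrow> complex) \<Rightarrow> bool" for bs where
  eigen: "functional \<phi> \<Longrightarrow> \<forall>b\<in>bs. \<exists>\<beta>. \<forall>x\<in>K. \<phi> (b * x) = \<beta> * \<phi> x \<Longrightarrow> eigen_sum bs \<phi>"
| add: "eigen_sum bs \<phi> \<Longrightarrow> eigen_sum bs \<psi> \<Longrightarrow> \<forall>x\<in>K. \<rho> x = \<phi> x + \<psi> x \<Longrightarrow> eigen_sum bs \<rho>"

lemma eigen_sum_sum:
  assumes "finite R" "bs \<subseteq> K" "\<And>r. r \<in> R \<Longrightarrow> eigen_sum bs (\<psi> r)"
    and "\<And>x. x \<in> K \<Longrightarrow> \<phi> x = (\<Sum>r\<in>R. \<psi> r x)"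
  shows "eigen_sum bs \<phi>"
  using assms(1,3,4)
proof (induction R arbitrary: \<phi>)
  case empty
  have "r * x \<in> K" if "r \<in> \<rat>" "x \<in> K" for r x using that rat_subset mult_closed by blast
  hence "functional \<phi>" using empty by (simp add: functional_def add_closed)
  moreover have "\<forall>b\<in>bs. \<exists>\<beta>. \<forall>x\<in>K. \<phi> (b * x) = \<beta> * \<phi> x"
    using empty assms(2) mult_closed by (auto intro!: exI[of _ 0])
  ultimately show ?case by (rule eigen)
next
  case (insert r R)
  have "eigen_sum bs (\<lambda>x. \<Sum>r\<in>R. \<psi> r x)"
    by (rule insert.IH) (simp_all add: insert.prems(1))
  moreover have "eigen_sum bs (\<psi> r)" by (simp add: insert.prems(1))
  ultimately show ?case
    by (rule add) (use insert.prems(2) insert.hyps in \<open>simp add: add.commute\<close>)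
qed

text \<open>Multiplications commute, so the common eigenspaces for the earlier elements are stable
  under multiplication by a new \<open>a\<close>. The minimal polynomial of \<open>a\<close>
  annihilates that operator and has simple roots, so each summand splits further.\<close>

lemma functional_imp_eigen_sum:
  assumes alg: "\<And>x. x \<in> K \<Longrightarrow> algebraic x"
    and "finite bs" "bs \<subseteq> K" "functional \<phi>"
  shows "eigen_sum bs \<phi>"
  using assms(2,3)
proof (induction bs)
  case empty
  thus ?case using assms(4) by (intro eigen) auto
next
  case (insert a bs)
  have a: "a \<in> K" and bs: "bs \<subseteq> K" using insert.prems by auto
  have "eigen_sum bs \<phi>" using insert by auto
  thus ?case
  proof induction
    case (add \<phi> \<psi> \<rho>)
    thus ?case using eigen_sum.add[of "insert a bs" \<phi> \<psi> \<rho>] by blast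
  next
    case (eigen \<phi>)
    from bchoice[OF eigen(2)] obtain \<beta> where \<beta>: "\<And>b x. b \<in> bs \<Longrightarrow> x \<in> K \<Longrightarrow> \<phi> (b * x) = \<beta> b * \<phi> x"
      by blast
    obtain q :: "rat poly" where q: "lead_coeff q = 1" "Factorial_Ring.irreducible q"
        "poly (map_poly of_rat q) a = 0"
      using algebraic_imp_root_of_monic_irreducible[OF alg[OF a]] by blast
    define Q :: "complex poly" where "Q = map_poly of_rat q"
    define R where "R = {z. poly Q z = 0}"
    \<comment> \<open>The common eigenspace of the summand at hand; decomposing inside it preserves
      the eigenvalues for \<open>bs\<close>.\<close>
    define W where "W = {\<psi>. functional \<psi> \<and> (\<forall>b\<in>bs. \<forall>x\<in>K. \<psi> (b * x) = \<beta> b * \<psi> x)}"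
    have Q: "Q \<noteq> 0" "\<And>i. coeff Q i \<in> \<rat>" using q(1) by (auto simp: Q_def)
    have "\<exists>\<psi>. (\<forall>r\<in>R. \<psi> r \<in> W \<and> (\<forall>x\<in>K. \<psi> r (a * x) = r * \<psi> r x)) \<and>
             (\<forall>x\<in>K. \<phi> x = (\<Sum>r\<in>R. \<psi> r x))"
    proof (rule eigenvector_decomposition)
      show "finite R" unfolding R_def using Q(1) by (rule poly_roots_finite)
      show "algebraic r" if "r \<in> R" for r
        using that Q by (auto simp: R_def algebraic_altdef)
      show "(\<lambda>x. \<phi> x + \<psi> x) \<in> W" if "\<phi> \<in> W" "\<psi> \<in> W" for \<phi> \<psi>
        using that by (auto simp: W_def functional_def algebra_simps intro!: algebraic_add)
      show "(\<lambda>x. c * \<phi> x) \<in> W" if "algebraic c" "\<phi> \<in> W" for c \<phi>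
        using that by (auto simp: W_def functional_def algebra_simps intro!: algebraic_mult)
      show "(\<lambda>x. \<phi> (a * x)) \<in> W" if \<phi>: "\<phi> \<in> W" for \<phi>
      proof -
        have "\<phi> (a * (r * x)) = r * \<phi> (a * x)" if "r \<in> \<rat>" "x \<in> K" for r x
        proof -
          have "\<phi> (a * (r * x)) = \<phi> (r * (a * x))" by (simp only: mult.left_commute)
          thus ?thesis using \<phi> that mult_closed[OF a that(2)] by (simp add: W_def functional_def)
        qed
        moreover have "\<phi> (a * (b * x)) = \<beta> b * \<phi> (a * x)" if "b \<in> bs" "x \<in> K" for b x
        proof -
          have "\<phi> (a * (b * x)) = \<phi> (b * (a * x))" by (simp only: mult.left_commute)
          thus ?thesis using \<phi> that mult_closed[OF a that(2)] by (simp add: W_def)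
        qed
        ultimately show ?thesis
          using \<phi> a by (simp add: W_def functional_def mult_closed distrib_left)
      qed
      show "\<phi> \<in> W" using eigen \<beta> by (simp add: W_def)
      fix x assume x: "x \<in> K"
      have "shift_act a \<phi> Q x = \<phi> (poly Q a * x)"
        unfolding shift_act_def using eigen(1) Q(2) a x by (rule functional_poly[symmetric])
      also have "\<dots> = 0" using q(3) functional_0[OF eigen(1)] by (simp add: Q_def)
      also have "Q = (\<Prod>r\<in>R. [:- r, 1:])"
        using irreducible_rat_poly_splits[OF q(2,1)] by (simp add: Q_def R_def)
      finally show "shift_act a \<phi> (\<Prod>r\<in>R. [:- r, 1:]) x = 0" .
    qed
    then obtain \<psi> where \<psi>: "\<And>r. r \<in> R \<Longrightarrow> \<psi> r \<in> W"
        "\<And>r x. r \<in> R \<Longrightarrow> x \<in> K \<Longrightarrow> \<psi> r (a * x) = r * \<psi> r x"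
        "\<And>x. x \<in> K \<Longrightarrow> \<phi> x = (\<Sum>r\<in>R. \<psi> r x)"
      by blast
    show ?case
    proof (rule eigen_sum_sum[of R _ \<psi>])
      show "finite R" unfolding R_def using Q(1) by (rule poly_roots_finite)
      fix r assume r: "r \<in> R"
      show "eigen_sum (insert a bs) (\<psi> r)"
        using \<psi>(1)[OF r] \<psi>(2)[OF r] by (intro eigen_sum.eigen) (auto simp: W_def)
    qed (use insert.prems \<psi>(3) in auto)
  qed
qed

section \<open>Denominators and sizes of functionals\<close>

text \<open>The eigenvalue map \<rho> acts as a field embedding:
  \<open>\<phi> (x ^ i) = \<rho> x ^ i * \<phi> 1\<close>, so applying \<phi> to a rational equation
  of \<open>x\<close> gives the same equation for \<open>\<rho> x\<close>, up to the factor
  \<open>\<phi> 1\<close>.\<close>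

lemma eigenfunctional_rational_root:
  assumes \<phi>: "functional \<phi>" "\<phi> 1 \<noteq> 0"
    and \<rho>: "\<And>a x. a \<in> K \<Longrightarrow> x \<in> K \<Longrightarrow> \<phi> (a * x) = \<rho> a * \<phi> x"
    and f: "\<And>i. coeff f i \<in> \<rat>" "poly f x = 0" and x: "x \<in> K"
  shows "poly f (\<rho> x) = 0"
proof -
  have pow: "\<phi> (x ^ i) = \<rho> x ^ i * \<phi> 1" for i
    by (induction i) (use \<rho>[OF x power_closed[OF x]] in auto)
  have "0 = \<phi> (poly f x * 1)" using f(2) functional_0[OF \<phi>(1)] by simp
  also have "\<dots> = (\<Sum>i\<le>degree f. coeff f i * \<phi> (x ^ i * 1))"
    using \<phi>(1) f(1) x one_closed by (rule functional_poly)
  also have "\<dots> = poly f (\<rho> x) * \<phi> 1"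
    by (simp add: pow poly_altdef sum_distrib_right mult.assoc)
  finally show ?thesis using \<phi>(2) by simp
qed

text \<open>A common eigenvector is an embedding \<rho> times the constant \<open>\<phi> 1\<close>,
  and \<open>\<rho> p\<close> is a conjugate of \<open>p\<close>, integral if \<open>p\<close> is;
  so the denominator and modulus of \<open>\<phi> 1\<close> suffice. For a sum, denominators
  multiply and bounds add. The hypothesis \<open>span\<close> states, as an induction principle,
  that \<open>bs\<close> spans \<open>K\<close> over the rationals.\<close>

lemma functional_denominator_and_size:
  assumes alg: "\<And>x. x \<in> K \<Longrightarrow> algebraic x"
    and bs: "finite bs" "bs \<subseteq> K"
    and span: "\<And>S. 0 \<in> S \<Longrightarrow> (\<And>r u v. r \<in> \<rat> \<Longrightarrow> u \<in> bs \<Longrightarrow> v \<in> S \<Longrightarrow> r * u + v \<in> S) \<Longrightarrow> K \<subseteq> S"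
    and \<phi>: "functional \<phi>"
  shows "\<exists>D C. D > (0::nat) \<and> C \<ge> (0::real) \<and>
    (\<forall>p\<in>K. algebraic_int p \<longrightarrow> algebraic_int (of_nat D * \<phi> p)) \<and>
    (\<forall>p\<in>K. \<forall>B. (\<forall>z\<in>galois_conjugates p. cmod z \<le> B) \<longrightarrow> cmod (\<phi> p) \<le> C * B)"
proof -
  have "eigen_sum bs \<phi>" using alg bs \<phi> by (rule functional_imp_eigen_sum)
  thus ?thesis
  proof induction
    case (eigen \<phi>)
    \<comment> \<open>The elements whose multiplication acts on \<phi> as a scalar; closure under
      rational combinations extends this from \<open>bs\<close> to all of \<open>K\<close>.\<close>
    define S where "S = {a \<in> K. \<exists>\<beta>. \<forall>x\<in>K. \<phi> (a * x) = \<beta> * \<phi> x}"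
    have "K \<subseteq> S"
    proof (rule span)
      show "0 \<in> S" using functional_0[OF eigen(1)] zero_closed by (auto simp: S_def intro!: exI[of _ 0])
      fix r u v :: complex assume r: "r \<in> \<rat>" and u: "u \<in> bs" and v: "v \<in> S"
      obtain \<beta> where \<beta>: "\<And>x. x \<in> K \<Longrightarrow> \<phi> (u * x) = \<beta> * \<phi> x" using eigen(2) u by blast
      obtain \<gamma> where \<gamma>: "\<And>x. x \<in> K \<Longrightarrow> \<phi> (v * x) = \<gamma> * \<phi> x" using v by (auto simp: S_def)
      have uv: "u \<in> K" "v \<in> K" "r \<in> K" using u bs v r rat_subset by (auto simp: S_def)
      have "\<phi> ((r * u + v) * x) = (r * \<beta> + \<gamma>) * \<phi> x" if x: "x \<in> K" for x
      proof -
        have "\<phi> ((r * u + v) * x) = \<phi> (r * (u * x) + v * x)" by (simp add: algebra_simps)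
        also have "\<dots> = r * \<phi> (u * x) + \<phi> (v * x)"
          using eigen(1) uv x r by (simp add: functional_def mult_closed)
        finally show ?thesis using \<beta>[OF x] \<gamma>[OF x] by (simp add: algebra_simps)
      qed
      thus "r * u + v \<in> S" unfolding S_def using uv by (auto intro!: add_closed mult_closed)
    qed
    hence "\<forall>a\<in>K. \<exists>\<beta>. \<forall>x\<in>K. \<phi> (a * x) = \<beta> * \<phi> x" by (auto simp: S_def)
    from bchoice[OF this] obtain \<rho> where \<rho>: "\<And>a x. a \<in> K \<Longrightarrow> x \<in> K \<Longrightarrow> \<phi> (a * x) = \<rho> a * \<phi> x"
      by blast
    have \<phi>\<rho>: "\<phi> a = \<rho> a * \<phi> 1" if "a \<in> K" for a using \<rho>[OF that one_closed] by simp
    show ?case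
    proof (cases "\<phi> 1 = 0")
      case True
      hence "\<phi> a = 0" if "a \<in> K" for a using \<phi>\<rho>[OF that] by simp
      thus ?thesis by (intro exI[of _ 1] exI[of _ 0]) auto
    next
      case False
      note root = eigenfunctional_rational_root[OF eigen(1) False \<rho>]
      obtain D :: nat where D: "D > 0" "algebraic_int (of_nat D * \<phi> 1)"
        using eigen(1) one_closed unfolding functional_def algebraic_iff_multiple_algebraic_int by blast
      show ?thesis
      proof (intro exI[of _ D] exI[of _ "cmod (\<phi> 1)"] conjI ballI impI allI D(1) norm_ge_zero)
        fix p assume p: "p \<in> K" "algebraic_int p"
        then obtain f where f: "poly (map_poly of_int f) p = 0" "lead_coeff f = 1"
          unfolding algebraic_int_altdef_ipoly by blast
        have "poly (map_poly of_int f) (\<rho> p) = 0" using f(1) p(1) by (intro root) auto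
        hence "algebraic_int (\<rho> p)" unfolding algebraic_int_altdef_ipoly using f(2) by blast
        from algebraic_int_mult[OF this D(2)] show "algebraic_int (of_nat D * \<phi> p)"
          using \<phi>\<rho>[OF p(1)] by (simp add: mult_ac)
      next
        fix p B assume p: "p \<in> K" and B: "\<forall>z\<in>galois_conjugates p. cmod z \<le> B"
        obtain q :: "rat poly" where q: "lead_coeff q = 1" "Factorial_Ring.irreducible q"
            "poly (map_poly of_rat q) p = 0"
          using algebraic_imp_root_of_monic_irreducible[OF alg[OF p]] by blast
        have "poly (map_poly of_rat q) (\<rho> p) = 0" using q(3) p by (intro root) auto
        \<comment> \<open>The same irreducible \<open>q\<close> vanishes at \<open>p\<close> and at
          \<open>\<rho> p\<close>.\<close>
        hence "\<rho> p \<in> galois_conjugates p" unfolding galois_conjugates_def using q by blast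
        hence "cmod (\<rho> p) \<le> B" using B by blast
        hence "cmod (\<phi> 1) * cmod (\<rho> p) \<le> cmod (\<phi> 1) * B" by (rule mult_left_mono) simp
        thus "cmod (\<phi> p) \<le> cmod (\<phi> 1) * B" using \<phi>\<rho>[OF p] by (simp add: norm_mult mult.commute)
      qed
    qed
  next
    case (add \<phi> \<psi> \<rho>)
    from add.IH(1) obtain D C where \<phi>: "D > (0::nat)" "C \<ge> (0::real)"
      "\<forall>p\<in>K. algebraic_int p \<longrightarrow> algebraic_int (of_nat D * \<phi> p)"
      "\<forall>p\<in>K. \<forall>B. (\<forall>z\<in>galois_conjugates p. cmod z \<le> B) \<longrightarrow> cmod (\<phi> p) \<le> C * B"
      by (elim exE conjE) (rule that)
    from add.IH(2) obtain D' C' where \<psi>: "D' > (0::nat)" "C' \<ge> (0::real)"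
      "\<forall>p\<in>K. algebraic_int p \<longrightarrow> algebraic_int (of_nat D' * \<psi> p)"
      "\<forall>p\<in>K. \<forall>B. (\<forall>z\<in>galois_conjugates p. cmod z \<le> B) \<longrightarrow> cmod (\<psi> p) \<le> C' * B"
      by (elim exE conjE) (rule that)
    show ?case
    proof (intro exI[of _ "D * D'"] exI[of _ "C + C'"] conjI ballI impI allI)
      fix p assume p: "p \<in> K" "algebraic_int p"
      have "algebraic_int (of_nat D' * (of_nat D * \<phi> p) + of_nat D * (of_nat D' * \<psi> p))"
        by (rule algebraic_int_add[OF
              algebraic_int_mult[OF algebraic_int_of_nat \<phi>(3)[rule_format, OF p]]
              algebraic_int_mult[OF algebraic_int_of_nat \<psi>(3)[rule_format, OF p]]])
      thus "algebraic_int (of_nat (D * D') * \<rho> p)" using add.hyps(3) p by (simp add: algebra_simps)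
    next
      fix p B assume p: "p \<in> K" "\<forall>z\<in>galois_conjugates p. cmod z \<le> B"
      have "cmod (\<rho> p) \<le> cmod (\<phi> p) + cmod (\<psi> p)" using add.hyps(3) p norm_triangle_ineq by simp
      also have "\<dots> \<le> (C + C') * B" 
        using \<phi>(4)[rule_format, OF p(1), of B] \<psi>(4)[rule_format, OF p(1), of B] p(2)
        by (simp add: distrib_right)
      finally show "cmod (\<rho> p) \<le> (C + C') * B" .
    qed (use \<phi> \<psi> in auto)
  qed
qed

end

section \<open>Coordinates over a number field\<close>

lemma complex_field_simps [simp]:
  "carrier complex_field = UNIV" "x \<otimes>\<^bsub>complex_field\<^esub> y = x * y"
  "x \<oplus>\<^bsub>complex_field\<^esub> y = x + y" "\<one>\<^bsub>complex_field\<^esub> = 1" "\<zero>\<^bsub>complex_field\<^esub> = 0"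
  by (simp_all add: ring_of_type_algebra_def)

interpretation CF: ring complex_field
  by (rule ring_from_type_algebra)

declare CF.Span.simps [simp del]

lemma Span_Nil [simp]: "CF.Span F [] = {0}"
  by (simp add: CF.Span.simps)

lemma Span_Cons_mem_iff: "v \<in> CF.Span F (u # us) \<longleftrightarrow> (\<exists>k\<in>F. \<exists>w\<in>CF.Span F us. v = k * u + w)"
  by (simp add: CF.Span.simps CF.line_extension_mem_iff)

lemma complex_field_a_inv [simp]: "\<ominus>\<^bsub>complex_field\<^esub> x = - x"
  by (rule CF.minus_equality) auto

lemma complex_field_m_inv [simp]: "x \<noteq> 0 \<Longrightarrow> inv\<^bsub>complex_field\<^esub> x = inverse x"
proof -
  interpret field complex_field by (rule field_from_type_algebra)
  assume "x \<noteq> 0"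
  thus ?thesis by (intro comm_inv_char) auto
qed

lemma complex_field_nat_pow [simp]: "x [^]\<^bsub>complex_field\<^esub> (n::nat) = x ^ n"
  by (induction n) (simp_all add: mult.commute)

lemma subfield_Rats: "subfield \<rat> complex_field"
proof -
  interpret field complex_field by (rule field_from_type_algebra)
  show ?thesis by (rule subfieldI'[OF CF.subringI]) auto
qed

text \<open>In this form it supplies the hypothesis \<open>span\<close> of
  \<open>functional_denominator_and_size\<close>.\<close>

lemma Span_subset:
  assumes "0 \<in> S" "\<And>k u v. k \<in> F \<Longrightarrow> u \<in> set us \<Longrightarrow> v \<in> S \<Longrightarrow> k * u + v \<in> S"
  shows "CF.Span F us \<subseteq> S"
  using assms(2)
proof (induction us)
  case Nil
  thus ?case using assms(1) by simp
next
  case (Cons u us)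
  have "CF.Span F us \<subseteq> S" using Cons by simp
  show ?case
  proof
    fix v assume "v \<in> CF.Span F (u # us)"
    then obtain k w where "k \<in> F" "w \<in> CF.Span F us" "v = k * u + w" unfolding Span_Cons_mem_iff by blast
    thus "v \<in> S" using Cons.prems[of k u w] \<open>CF.Span F us \<subseteq> S\<close> by auto
  qed
qed

text \<open>Polynomials of HOL-Algebra list the leading coefficient first, \<open>Poly\<close> lists
  the constant term first; hence the reversal.\<close>

lemma eval_complex_field: "CF.eval p x = poly (Poly (rev p)) x"
  by (induction p) (simp_all add: Poly_append poly_monom)

lemma algebraic_over_Rats_imp_algebraic:
  assumes "(CF.algebraic over \<rat>) x"
  shows "algebraic x"
proof -
  interpret field complex_field by (rule field_from_type_algebra)
  obtain p where p: "p \<in> carrier (univ_poly complex_field \<rat>)" "p \<noteq> []" "CF.eval p x = 0"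
    using algebraicE[OF subfieldE(1)[OF subfield_Rats] _ assms] by auto
  have poly: "set p \<subseteq> \<rat>" "hd p \<noteq> 0"
    using p(1,2) by (auto simp: univ_poly_def polynomial_def)
  show ?thesis
  proof (rule algebraicI')
    fix i show "coeff (Poly (rev p)) i \<in> \<rat>"
      using poly(1) nth_mem[of i "rev p"] by (auto simp: nth_default_def)
    have "coeff (Poly (rev p)) (length p - 1) = hd p"
      using p(2) by (simp add: nth_default_def rev_nth hd_conv_nth)
    thus "Poly (rev p) \<noteq> 0" using poly(2) by (metis coeff_0)
    show "poly (Poly (rev p)) x = 0" using p(3) by (simp add: eval_complex_field)
  qed
qed

lemma subfield_closed:
  assumes F: "subfield F complex_field"
  shows "0 \<in> F" "1 \<in> F" "x \<in> F \<Longrightarrow> y \<in> F \<Longrightarrow> x + y \<in> F" "x \<in> F \<Longrightarrow> y \<in> F \<Longrightarrow> x * y \<in> F"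
    "x \<in> F \<Longrightarrow> - x \<in> F" "x \<in> F \<Longrightarrow> x \<noteq> 0 \<Longrightarrow> inverse x \<in> F"
  using subringE[OF subfieldE(1)[OF F]] CF.subfield_m_inv(1)[OF F, of x] by auto

lemma Span_closed:
  assumes "subfield F complex_field"
  shows "0 \<in> CF.Span F us" "v \<in> CF.Span F us \<Longrightarrow> w \<in> CF.Span F us \<Longrightarrow> v + w \<in> CF.Span F us"
    "k \<in> F \<Longrightarrow> v \<in> CF.Span F us \<Longrightarrow> k * v \<in> CF.Span F us"
  using CF.Span_subgroup_props(2,3)[OF assms, of us] CF.Span_smult_closed[OF assms, of us] by simp_all

text \<open>The coefficient of the first vector is unique because that vector lies outside the span
  of the others, and uniqueness makes it linear. The remaining coordinates come from the induction
  hypothesis after subtracting this part.\<close>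

lemma independent_coordinates:
  assumes F: "subfield F complex_field" and "CF.independent F us"
  shows "\<exists>l :: nat \<Rightarrow> complex \<Rightarrow> complex. \<forall>v\<in>CF.Span F us.
     (\<forall>s<length us. l s v \<in> F) \<and> v = (\<Sum>s<length us. l s v * us ! s) \<and>
     (\<forall>s<length us. \<forall>w\<in>CF.Span F us. l s (v + w) = l s v + l s w) \<and>
     (\<forall>s<length us. \<forall>k\<in>F. l s (k * v) = k * l s v)"
  using assms(2)
proof (induction us rule: list.induct)
  case Nil
  show ?case by simp
next
  case (Cons u us)
  note indep = CF.independent_backwards[OF Cons.prems]
  obtain l where l:
     "\<And>v s. v \<in> CF.Span F us \<Longrightarrow> s < length us \<Longrightarrow> l s v \<in> F"
     "\<And>v. v \<in> CF.Span F us \<Longrightarrow> v = (\<Sum>s<length us. l s v * us ! s)"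
     "\<And>v w s. v \<in> CF.Span F us \<Longrightarrow> w \<in> CF.Span F us \<Longrightarrow> s < length us \<Longrightarrow> l s (v + w) = l s v + l s w"
     "\<And>k v s. k \<in> F \<Longrightarrow> v \<in> CF.Span F us \<Longrightarrow> s < length us \<Longrightarrow> l s (k * v) = k * l s v"
    using Cons.IH[OF indep(2)] by blast
  note F_closed = subfield_closed[OF F]
  have mem: "v \<in> CF.Span F (u # us) \<longleftrightarrow> (\<exists>k\<in>F. v - k * u \<in> CF.Span F us)" for v
    unfolding Span_Cons_mem_iff by (metis add_diff_cancel_left' add.commute diff_add_cancel)
  \<comment> \<open>Two distinct coefficients would, after division by their difference, put
    \<open>u\<close> into the span of \<open>us\<close>.\<close>
  have unique: "k = k'" if k: "k \<in> F" "k' \<in> F" "v - k * u \<in> CF.Span F us" "v - k' * u \<in> CF.Span F us" for k k' v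
  proof (rule ccontr)
    assume "k \<noteq> k'"
    have inv: "inverse (k' - k) \<in> F"
      using F_closed(6)[of "k' - k"] F_closed(3)[of k' "- k"] F_closed(5)[of k] k \<open>k \<noteq> k'\<close> by auto
    have "- 1 \<in> F" using F_closed(2,5) by simp
    have "(v - k * u) + (-1) * (v - k' * u) \<in> CF.Span F us"
      using Span_closed[OF F] k \<open>- 1 \<in> F\<close> by blast
    hence "inverse (k' - k) * ((v - k * u) + (-1) * (v - k' * u)) \<in> CF.Span F us"
      using Span_closed(3)[OF F inv] by blast
    also have "inverse (k' - k) * ((v - k * u) + (-1) * (v - k' * u)) = u"
      using \<open>k \<noteq> k'\<close> by (simp add: field_simps)
    finally show False using indep(1) by simp
  qed
  define \<kappa> where "\<kappa> = (\<lambda>v. THE k. k \<in> F \<and> v - k * u \<in> CF.Span F us)"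
  have \<kappa>_eq: "\<kappa> v = k" if "k \<in> F" "v - k * u \<in> CF.Span F us" for v k
    unfolding \<kappa>_def using that unique by blast
  have \<kappa>: "\<kappa> v \<in> F" "v - \<kappa> v * u \<in> CF.Span F us" if "v \<in> CF.Span F (u # us)" for v
    using that \<kappa>_eq unfolding mem by auto
  have \<kappa>_add: "\<kappa> (v + w) = \<kappa> v + \<kappa> w" if "v \<in> CF.Span F (u # us)" "w \<in> CF.Span F (u # us)" for v w
  proof (rule \<kappa>_eq)
    show "\<kappa> v + \<kappa> w \<in> F" using \<kappa> that F_closed by simp
    have "(v - \<kappa> v * u) + (w - \<kappa> w * u) \<in> CF.Span F us"
      using \<kappa>(2) that by (intro Span_closed(2)[OF F])
    thus "v + w - (\<kappa> v + \<kappa> w) * u \<in> CF.Span F us" by (simp add: algebra_simps)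
  qed
  have \<kappa>_scale: "\<kappa> (k * v) = k * \<kappa> v" if "v \<in> CF.Span F (u # us)" "k \<in> F" for v k
  proof (rule \<kappa>_eq)
    show "k * \<kappa> v \<in> F" using \<kappa> that F_closed by simp
    have "k * (v - \<kappa> v * u) \<in> CF.Span F us"
      using \<kappa>(2) that by (intro Span_closed(3)[OF F])
    thus "k * v - k * \<kappa> v * u \<in> CF.Span F us" by (simp add: algebra_simps)
  qed
  define l' where "l' = (\<lambda>s v. case s of 0 \<Rightarrow> \<kappa> v | Suc s \<Rightarrow> l s (v - \<kappa> v * u))"
  show ?case
  proof (intro exI[of _ l'] ballI conjI allI impI)
    fix v assume v: "v \<in> CF.Span F (u # us)"
    have "v = \<kappa> v * u + (\<Sum>s<length us. l s (v - \<kappa> v * u) * us ! s)"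
      using l(2)[OF \<kappa>(2)[OF v]] by (simp add: algebra_simps)
    thus "v = (\<Sum>s<length (u # us). l' s v * (u # us) ! s)"
      by (simp add: l'_def sum.lessThan_Suc_shift del: sum.lessThan_Suc)
    fix s assume s: "s < length (u # us)"
    show "l' s v \<in> F" using s \<kappa>[OF v] l(1) by (auto simp: l'_def split: nat.splits)
    show "l' s (v + w) = l' s v + l' s w" if w: "w \<in> CF.Span F (u # us)" for w
    proof (cases s)
      case (Suc s')
      have "v + w - \<kappa> (v + w) * u = (v - \<kappa> v * u) + (w - \<kappa> w * u)"
        by (simp add: \<kappa>_add[OF v w] algebra_simps)
      hence "l' s (v + w) = l s' ((v - \<kappa> v * u) + (w - \<kappa> w * u))"
        by (simp only: l'_def Suc nat.case)
      thus ?thesis using Suc s l(3)[OF \<kappa>(2)[OF v] \<kappa>(2)[OF w]] by (simp add: l'_def)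
    qed (simp add: l'_def \<kappa>_add[OF v w])
    show "l' s (k * v) = k * l' s v" if k: "k \<in> F" for k
    proof (cases s)
      case (Suc s')
      have "k * v - \<kappa> (k * v) * u = k * (v - \<kappa> v * u)"
        by (simp add: \<kappa>_scale[OF v k] algebra_simps)
      hence "l' s (k * v) = l s' (k * (v - \<kappa> v * u))"
        by (simp only: l'_def Suc nat.case)
      thus ?thesis using Suc s l(4)[OF k \<kappa>(2)[OF v]] by (simp add: l'_def)
    qed (simp add: l'_def \<kappa>_scale[OF v k])
  qed
qed

section \<open>Integer coordinates on the span over a number field\<close>

lemma number_field_rat_subalgebra:
  assumes "number_field K"
  shows "rat_subalgebra K"
proof
  have K: "subfield K complex_field" "CF.finite_dimension \<rat> K" using assms by (auto simp: number_field_def)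
  then obtain n us where us: "CF.Span \<rat> us = K"
    using CF.exists_base[OF subfield_Rats] unfolding CF.finite_dimension_def by blast
  show "x + y \<in> K" "x * y \<in> K" if "x \<in> K" "y \<in> K" for x y
    using that subfield_closed[OF K(1)] by auto
  show "\<rat> \<subseteq> K"
    using Span_closed(3)[OF subfield_Rats, of _ 1 us] subfield_closed(2)[OF K(1)] unfolding us by auto
qed

text \<open>By the tower law the \<open>K\<close>-span has dimension \<open>M\<close> over the
  rationals. For a rational basis \<open>v\<close> of it, \<open>l s j x\<close> is the coordinate
  with index \<open>s\<close> of \<open>x * \<theta> j\<close>.\<close>

lemma number_field_coordinates:
  fixes \<theta> :: "nat \<Rightarrow> complex" and N :: nat
  assumes K: "number_field K"
  defines "M \<equiv> number_field_degree K * (CF.dim over K) (CF.Span K (map \<theta> [1..<Suc N]))"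
  obtains v :: "nat \<Rightarrow> complex" and l :: "nat \<Rightarrow> nat \<Rightarrow> complex \<Rightarrow> complex"
  where "\<And>s j. s < M \<Longrightarrow> j \<in> {1..N} \<Longrightarrow> rat_subalgebra.functional K (l s j)"
    and "\<And>s j x. s < M \<Longrightarrow> j \<in> {1..N} \<Longrightarrow> x \<in> K \<Longrightarrow> l s j x \<in> \<rat>"
    and "\<And>j x. j \<in> {1..N} \<Longrightarrow> x \<in> K \<Longrightarrow> x * \<theta> j = (\<Sum>s<M. l s j x * v s)"
proof -
  interpret rat_subalgebra K using K by (rule number_field_rat_subalgebra)
  define \<theta>s where "\<theta>s = map \<theta> [1..<Suc N]"
  define V where "V = CF.Span K \<theta>s"
  have sub: "subfield K complex_field" and fin: "CF.finite_dimension \<rat> K"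
    using K by (auto simp: number_field_def)
  have "CF.dimension (number_field_degree K) \<rat> K"
    unfolding number_field_degree_def using subfield_Rats fin by (rule CF.finite_dimensionE)
  moreover have "CF.dimension ((CF.dim over K) V) K V"
    unfolding V_def using sub
    by (intro CF.finite_dimensionE CF.Span_finite_dimension) auto
  ultimately have "CF.dimension M \<rat> V"
    unfolding M_def \<theta>s_def[symmetric] V_def[symmetric] by (rule CF.telescopic_base[OF subfield_Rats sub])
  then obtain vs where vs: "CF.independent \<rat> vs" "length vs = M" "CF.Span \<rat> vs = V"
    using CF.exists_base[OF subfield_Rats] by blast
  obtain L where L: "\<And>v s. v \<in> V \<Longrightarrow> s < M \<Longrightarrow> L s v \<in> \<rat>"
     "\<And>v. v \<in> V \<Longrightarrow> v = (\<Sum>s<M. L s v * vs ! s)"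
     "\<And>v w s. v \<in> V \<Longrightarrow> w \<in> V \<Longrightarrow> s < M \<Longrightarrow> L s (v + w) = L s v + L s w"
     "\<And>k v s. k \<in> \<rat> \<Longrightarrow> v \<in> V \<Longrightarrow> s < M \<Longrightarrow> L s (k * v) = k * L s v"
    using independent_coordinates[OF subfield_Rats vs(1)] unfolding vs(2,3) by blast
  have \<theta>V: "x * \<theta> j \<in> V" if "j \<in> {1..N}" "x \<in> K" for x j
  proof -
    have "\<theta> j \<in> set \<theta>s" using that unfolding \<theta>s_def set_map set_upt by (intro imageI) auto
    hence "\<theta> j \<in> V" using CF.Span_base_incl[OF sub, of \<theta>s] by (auto simp: V_def)
    thus ?thesis using that Span_closed(3)[OF sub] by (simp add: V_def)
  qed
  show thesis
  proof (rule that[of "\<lambda>s j x. L s (x * \<theta> j)" "\<lambda>s. vs ! s"])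
    fix s j assume sj: "s < M" "j \<in> {1..N}"
    have "L s (r * x * \<theta> j) = r * L s (x * \<theta> j)" if "r \<in> \<rat>" "x \<in> K" for r x
      using L(4)[OF that(1) \<theta>V[OF sj(2) that(2)] sj(1)] by (simp add: mult.assoc)
    thus "functional (\<lambda>x. L s (x * \<theta> j))"
      using L \<theta>V sj by (auto simp: functional_def distrib_right intro: rat_imp_algebraic)
  qed (use L \<theta>V in auto)
qed

text \<open>For an integer \<open>x\<close> of \<open>K\<close>, the multiple
  \<open>D * \<phi> x\<close> is both rational and an algebraic integer, hence an ordinary
  integer.\<close>

lemma number_field_functional_bound:
  assumes K: "number_field K" and \<phi>: "rat_subalgebra.functional K \<phi>" "\<And>x. x \<in> K \<Longrightarrow> \<phi> x \<in> \<rat>"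
  obtains D :: nat and C :: real where "D > 0" "C \<ge> 0"
    "\<And>x. x \<in> ring_of_integers K \<Longrightarrow> of_nat D * \<phi> x \<in> \<int>"
    "\<And>x B. x \<in> ring_of_integers K \<Longrightarrow> \<forall>z\<in>galois_conjugates x. cmod z \<le> B \<Longrightarrow> cmod (\<phi> x) \<le> C * B"
proof -
  interpret rat_subalgebra K using K by (rule number_field_rat_subalgebra)
  have sub: "subfield K complex_field" and fin: "CF.finite_dimension \<rat> K"
    using K by (auto simp: number_field_def)
  then obtain us where us: "CF.Span \<rat> us = K"
    using CF.exists_base[OF subfield_Rats] unfolding CF.finite_dimension_def by blast
  have usK: "set us \<subseteq> K" using CF.Span_base_incl[OF subfield_Rats, of us] us by simp
  have alg: "algebraic x" if "x \<in> K" for x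
    using CF.finite_dimension_imp_algebraic[OF subfield_Rats subfieldE(1)[OF sub] fin that]
    by (rule algebraic_over_Rats_imp_algebraic)
  have "\<exists>D C. D > (0::nat) \<and> C \<ge> (0::real) \<and>
    (\<forall>p\<in>K. algebraic_int p \<longrightarrow> algebraic_int (of_nat D * \<phi> p)) \<and>
    (\<forall>p\<in>K. \<forall>B. (\<forall>z\<in>galois_conjugates p. cmod z \<le> B) \<longrightarrow> cmod (\<phi> p) \<le> C * B)"
  proof (rule functional_denominator_and_size[OF alg finite_set usK _ \<phi>(1)])
    fix S assume "0 \<in> S" "\<And>r u v. r \<in> \<rat> \<Longrightarrow> u \<in> set us \<Longrightarrow> v \<in> S \<Longrightarrow> r * u + v \<in> S"
    thus "K \<subseteq> S" using Span_subset[of S \<rat> us] us by blast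
  qed
  then obtain D C where DC: "D > (0::nat)" "C \<ge> (0::real)"
    "\<forall>p\<in>K. algebraic_int p \<longrightarrow> algebraic_int (of_nat D * \<phi> p)"
    "\<forall>p\<in>K. \<forall>B. (\<forall>z\<in>galois_conjugates p. cmod z \<le> B) \<longrightarrow> cmod (\<phi> p) \<le> C * B"
    by (elim exE conjE) (rule that)
  show thesis
  proof (rule that[OF DC(1,2)])
    fix x assume x: "x \<in> ring_of_integers K"
    show "of_nat D * \<phi> x \<in> \<int>"
      using DC(3) x \<phi>(2) by (intro rational_algebraic_int_is_int) (auto simp: ring_of_integers_def)
    show "cmod (\<phi> x) \<le> C * B" if "\<forall>z\<in>galois_conjugates x. cmod z \<le> B" for B
      using DC(4)[rule_format, of x B] x that by (auto simp: ring_of_integers_def)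
  qed
qed

text \<open>The finitely many coordinate functionals share a denominator and a size constant. It
  matters that \<open>v\<close>, \<open>D\<close> and \<open>C\<close> are chosen before
  \<open>p\<close>, so that they serve all members of a sequence.\<close>

lemma number_field_integer_coordinates:
  fixes \<theta> :: "nat \<Rightarrow> complex" and N :: nat
  assumes K: "number_field K"
  defines "M \<equiv> number_field_degree K * (CF.dim over K) (CF.Span K (map \<theta> [1..<Suc N]))"
  obtains v :: "nat \<Rightarrow> complex" and D :: nat and C :: real where "D > 0" "C \<ge> 0"
    "\<forall>p. (\<forall>j\<in>{1..N}. p j \<in> ring_of_integers K) \<longrightarrow> (\<exists>m :: nat \<Rightarrow> int.
       (\<forall>s<M. \<forall>B\<ge>0. (\<forall>j\<in>{1..N}. \<forall>z\<in>galois_conjugates (p j). cmod z \<le> B) \<longrightarrow> \<bar>real_of_int (m s)\<bar> \<le> C * B) \<and>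
       of_nat D * (\<Sum>j=1..N. p j * \<theta> j) = (\<Sum>s<M. of_int (m s) * v s))"
proof -
  obtain l v where l: "\<And>s j. s < M \<Longrightarrow> j \<in> {1..N} \<Longrightarrow> rat_subalgebra.functional K (l s j)"
    "\<And>s j x. s < M \<Longrightarrow> j \<in> {1..N} \<Longrightarrow> x \<in> K \<Longrightarrow> l s j x \<in> \<rat>"
    "\<And>j x. j \<in> {1..N} \<Longrightarrow> x \<in> K \<Longrightarrow> x * \<theta> j = (\<Sum>s<M. l s j x * v s)"
    by (rule number_field_coordinates[OF K, where \<theta> = \<theta> and N = N, folded M_def]) (rule that)
  define I where "I = {..<M} \<times> {1..N}"
  have "\<forall>i\<in>I. \<exists>d :: nat \<times> real. fst d > 0 \<and> snd d \<ge> 0 \<and>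
    (\<forall>x\<in>ring_of_integers K. of_nat (fst d) * l (fst i) (snd i) x \<in> \<int>) \<and>
    (\<forall>x\<in>ring_of_integers K. \<forall>B. (\<forall>z\<in>galois_conjugates x. cmod z \<le> B) \<longrightarrow> cmod (l (fst i) (snd i) x) \<le> snd d * B)"
  proof
    fix i assume "i \<in> I"
    hence i: "fst i < M" "snd i \<in> {1..N}" by (auto simp: I_def)
    obtain D :: nat and C :: real where "D > 0" "C \<ge> 0"
      "\<And>x. x \<in> ring_of_integers K \<Longrightarrow> of_nat D * l (fst i) (snd i) x \<in> \<int>"
      "\<And>x B. x \<in> ring_of_integers K \<Longrightarrow> \<forall>z\<in>galois_conjugates x. cmod z \<le> B \<Longrightarrow> cmod (l (fst i) (snd i) x) \<le> C * B"
      by (rule number_field_functional_bound[OF K l(1)[OF i] l(2)[OF i]]) (assumption, rule that)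
    thus "\<exists>d :: nat \<times> real. fst d > 0 \<and> snd d \<ge> 0 \<and>
      (\<forall>x\<in>ring_of_integers K. of_nat (fst d) * l (fst i) (snd i) x \<in> \<int>) \<and>
      (\<forall>x\<in>ring_of_integers K. \<forall>B. (\<forall>z\<in>galois_conjugates x. cmod z \<le> B) \<longrightarrow> cmod (l (fst i) (snd i) x) \<le> snd d * B)"
      by (intro exI[of _ "(D, C)"]) simp
  qed
  from bchoice[OF this] obtain d :: "nat \<times> nat \<Rightarrow> nat \<times> real" where
    d: "\<forall>i\<in>I. fst (d i) > 0 \<and> snd (d i) \<ge> 0 \<and>
    (\<forall>x\<in>ring_of_integers K. of_nat (fst (d i)) * l (fst i) (snd i) x \<in> \<int>) \<and>
    (\<forall>x\<in>ring_of_integers K. \<forall>B. (\<forall>z\<in>galois_conjugates x. cmod z \<le> B) \<longrightarrow> cmod (l (fst i) (snd i) x) \<le> snd (d i) * B)"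
    by (rule exE)
  \<comment> \<open>A common multiple of all denominators; \<open>C\<close> adds the size bounds of
    all pairs and carries the factor \<open>D\<close>.\<close>
  define D where "D = (\<Prod>i\<in>I. fst (d i))"
  define C where "C = real D * (\<Sum>i\<in>I. snd (d i))"
  have fin: "finite I" by (simp add: I_def)
  have D: "D > 0" using d fin by (auto simp: D_def intro!: prod_pos)
  have C: "C \<ge> 0" using d fin by (auto simp: C_def intro!: mult_nonneg_nonneg sum_nonneg)
  have int: "of_nat D * l s j x \<in> \<int>" if "s < M" "j \<in> {1..N}" "x \<in> ring_of_integers K" for s j x
  proof -
    have sj: "(s, j) \<in> I" using that by (simp add: I_def)
    have "of_nat (fst (d (s, j))) * l s j x \<in> \<int>" using bspec[OF d sj] that(3) by simp
    note rest = Ints_mult[OF Ints_of_nat this, of "\<Prod>i\<in>I - {(s, j)}. fst (d i)"]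
    have "D = (\<Prod>i\<in>I - {(s, j)}. fst (d i)) * fst (d (s, j))"
      using prod.remove[OF fin sj, of "\<lambda>i. fst (d i)"] by (simp add: D_def mult.commute)
    hence "of_nat D * l s j x = of_nat (\<Prod>i\<in>I - {(s, j)}. fst (d i)) * (of_nat (fst (d (s, j))) * l s j x)"
      by (simp only: of_nat_mult mult.assoc)
    also note rest
    finally show ?thesis .
  qed
  show thesis
  proof (rule that[OF D C], intro allI impI)
    fix p assume "\<forall>j\<in>{1..N}. p j \<in> ring_of_integers K"
    hence p: "\<And>j. j \<in> {1..N} \<Longrightarrow> p j \<in> ring_of_integers K" by blast
    hence pK: "\<And>j. j \<in> {1..N} \<Longrightarrow> p j \<in> K" by (auto simp: ring_of_integers_def)
    define w where "w = (\<lambda>s. \<Sum>j=1..N. of_nat D * l s j (p j))"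
    have "\<forall>s\<in>{..<M}. \<exists>k::int. w s = of_int k"
    proof
      fix s assume "s \<in> {..<M}"
      hence "w s \<in> \<int>" using int p unfolding w_def by (intro Ints_sum) simp
      thus "\<exists>k::int. w s = of_int k" by (auto elim: Ints_cases)
    qed
    from bchoice[OF this] obtain m :: "nat \<Rightarrow> int" where m: "\<And>s. s < M \<Longrightarrow> w s = of_int (m s)" by blast
    have "of_nat D * (\<Sum>j=1..N. p j * \<theta> j) = (\<Sum>j=1..N. \<Sum>s<M. of_nat D * l s j (p j) * v s)"
      unfolding sum_distrib_left using l(3) pK by (intro sum.cong) (simp_all add: sum_distrib_left mult.assoc)
    also have "\<dots> = (\<Sum>s<M. \<Sum>j=1..N. of_nat D * l s j (p j) * v s)" by (rule sum.swap)
    also have "\<dots> = (\<Sum>s<M. of_int (m s) * v s)"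
      by (intro sum.cong) (simp_all add: m[symmetric] w_def sum_distrib_right)
    finally have eq: "of_nat D * (\<Sum>j=1..N. p j * \<theta> j) = (\<Sum>s<M. of_int (m s) * v s)" .
    have "\<bar>real_of_int (m s)\<bar> \<le> C * B"
      if s: "s < M" and B0: "B \<ge> 0" and B: "\<forall>j\<in>{1..N}. \<forall>z\<in>galois_conjugates (p j). cmod z \<le> B" for s B
    proof -
      have bound: "cmod (l s j (p j)) \<le> snd (d (s, j)) * B" if j: "j \<in> {1..N}" for j
        using bspec[OF d, of "(s, j)"] s j p[OF j] B by (auto simp: I_def)
      have "\<bar>real_of_int (m s)\<bar> = cmod (w s)" using m[OF s] by simp
      also have "\<dots> \<le> (\<Sum>j=1..N. real D * (snd (d (s, j)) * B))"
        unfolding w_def using bound by (intro sum_norm_le) (auto simp: norm_mult intro: mult_left_mono)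
      also have "\<dots> = real D * (\<Sum>j=1..N. snd (d (s, j))) * B"
        by (simp add: sum_distrib_left sum_distrib_right mult.assoc)
      also have "\<dots> \<le> real D * (\<Sum>s<M. \<Sum>j=1..N. snd (d (s, j))) * B"
      proof (intro mult_right_mono mult_left_mono B0)
        show "(\<Sum>j=1..N. snd (d (s, j))) \<le> (\<Sum>s<M. \<Sum>j=1..N. snd (d (s, j)))"
          using s d by (intro member_le_sum[of s _ "\<lambda>s. \<Sum>j=1..N. snd (d (s, j))"] sum_nonneg) (auto simp: I_def)
      qed simp
      also have "\<dots> = C * B"
        by (simp add: C_def I_def sum.cartesian_product)
      finally show ?thesis .
    qed
    with eq show "\<exists>m :: nat \<Rightarrow> int.
       (\<forall>s<M. \<forall>B\<ge>0. (\<forall>j\<in>{1..N}. \<forall>z\<in>galois_conjugates (p j). cmod z \<le> B) \<longrightarrow> \<bar>real_of_int (m s)\<bar> \<le> C * B) \<and>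
       of_nat D * (\<Sum>j=1..N. p j * \<theta> j) = (\<Sum>s<M. of_int (m s) * v s)"
      by (intro exI[of _ m]) blast
  qed
qed

section \<open>The dimension bound from the given linear forms\<close>

text \<open>Each o(1) is a null sequence of its own: \<delta> in the growth of \<open>Q\<close>,
  \<open>\<epsilon> j\<close> in the conjugate bound for each \<open>j\<close>, \<alpha> in the
  exponent of the linear form, and the complex \<eta> beside the exponential sum.\<close>

theorem theorem4:
  fixes K L :: "complex set"
    and Q :: "nat \<Rightarrow> real"
    and T N :: nat
    and c \<zeta> \<theta> :: "nat \<Rightarrow> complex"
    and \<tau> :: real
    and p :: "nat \<Rightarrow> nat \<Rightarrow> complex"
    and \<delta> \<alpha> :: "nat \<Rightarrow> real"
    and \<epsilon> :: "nat \<Rightarrow> nat \<Rightarrow> real"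
    and \<eta> :: "nat \<Rightarrow> complex"
  assumes K: "number_field K"
    and L: "L = (if K \<subseteq> \<real> then \<real> else UNIV)"
    and Q_pos: "\<And>n. Q n > 0"
    and Q_incseq: "incseq Q"
    and Q_lim: "filterlim Q at_top sequentially"
    and Q_step: "\<delta> \<longlonglongrightarrow> 0" "\<And>n. Q (Suc n) = Q n powr (1 + \<delta> n)"
    and T: "T \<ge> 1"
    and c: "\<And>t. t \<in> {1..T} \<Longrightarrow> c t \<noteq> 0"
    and \<zeta>_inj: "inj_on \<zeta> {1..T}"
    and \<zeta>_norm: "\<And>t. t \<in> {1..T} \<Longrightarrow> cmod (\<zeta> t) = 1"
    and \<theta>: "\<And>j. j \<in> {1..N} \<Longrightarrow> \<theta> j \<in> L"
    and \<tau>: "\<tau> > 0"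
    and p_int: "\<And>j n. j \<in> {1..N} \<Longrightarrow> p j n \<in> ring_of_integers K"
    and p_conj: "\<And>j. j \<in> {1..N} \<Longrightarrow> \<epsilon> j \<longlonglongrightarrow> 0"
      "\<And>j n z. j \<in> {1..N} \<Longrightarrow> z \<in> galois_conjugates (p j n) \<Longrightarrow>
         cmod z < Q n powr (1 + \<epsilon> j n)"
    and lin_form: "\<alpha> \<longlonglongrightarrow> 0" "\<eta> \<longlonglongrightarrow> 0"
      "\<And>n. (\<Sum>j=1..N. p j n * \<theta> j) =
         complex_of_real (Q n powr (- \<tau> + \<alpha> n)) * ((\<Sum>t=1..T. c t * \<zeta> t ^ n) + \<eta> n)"
  shows "real ((ring.dim complex_field over K) (ring.Span complex_field K (map \<theta> [1..<Suc N])))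
           \<ge> (\<tau> + 1) / real (number_field_degree K)"
proof -
  interpret slowly_growing Q \<delta>
    using Q_pos Q_incseq Q_lim Q_step by unfold_locales
  define M where "M = number_field_degree K * (CF.dim over K) (CF.Span K (map \<theta> [1..<Suc N]))"
  obtain v D C where D: "D > (0::nat)" and C: "C \<ge> (0::real)" and coords:
    "\<forall>p. (\<forall>j\<in>{1..N}. p j \<in> ring_of_integers K) \<longrightarrow> (\<exists>m :: nat \<Rightarrow> int.
       (\<forall>s<M. \<forall>B\<ge>0. (\<forall>j\<in>{1..N}. \<forall>z\<in>galois_conjugates (p j). cmod z \<le> B) \<longrightarrow> \<bar>real_of_int (m s)\<bar> \<le> C * B) \<and>
       of_nat D * (\<Sum>j=1..N. p j * \<theta> j) = (\<Sum>s<M. of_int (m s) * v s))"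
    by (rule number_field_integer_coordinates[OF K, where \<theta> = \<theta> and N = N, folded M_def]) (rule that)
  have "\<forall>n. \<exists>m :: nat \<Rightarrow> int.
       (\<forall>s<M. \<forall>B\<ge>0. (\<forall>j\<in>{1..N}. \<forall>z\<in>galois_conjugates (p j n). cmod z \<le> B) \<longrightarrow> \<bar>real_of_int (m s)\<bar> \<le> C * B) \<and>
       of_nat D * (\<Sum>j=1..N. p j n * \<theta> j) = (\<Sum>s<M. of_int (m s) * v s)"
    using p_int by (intro allI coords[rule_format])
  from choice[OF this] obtain m' :: "nat \<Rightarrow> nat \<Rightarrow> int" where m':
    "\<forall>n. (\<forall>s<M. \<forall>B\<ge>0. (\<forall>j\<in>{1..N}. \<forall>z\<in>galois_conjugates (p j n). cmod z \<le> B) \<longrightarrow> \<bar>real_of_int (m' n s)\<bar> \<le> C * B) \<and>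
       of_nat D * (\<Sum>j=1..N. p j n * \<theta> j) = (\<Sum>s<M. of_int (m' n s) * v s)"
    by (rule exE)
  have c1: "c 1 \<noteq> 0" and \<zeta>1: "cmod (\<zeta> 1) = 1" using c[of 1] \<zeta>_norm[of 1] T by auto
  obtain u \<kappa> G where u: "cmod u = 1" and \<kappa>: "\<kappa> > 0"
    "\<And>n. \<exists>i<G. \<kappa> \<le> \<bar>Re (u * (\<Sum>t=1..T. c t * \<zeta> t ^ (n + i)))\<bar>"
    by (rule Re_exponential_sum_bounded_below[where c = c and \<zeta> = \<zeta>, OF T c1 \<zeta>_inj \<zeta>1]) (rule that)
  \<comment> \<open>The coefficients \<open>m'\<close> are real, so the real part of
    \<open>u\<close> times the complex form is the same integer form in the real numbers
    \<open>x s\<close>.\<close>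
  define x where "x = (\<lambda>s. Re (u * v s))"
  define S where "S = (\<lambda>n. \<Sum>t=1..T. c t * \<zeta> t ^ n)"
  define \<Lambda> where "\<Lambda> = (\<lambda>n. \<Sum>s<M. real_of_int (m' n s) * x s)"
  have \<Lambda>: "\<Lambda> n = real D * Q n powr (- \<tau> + \<alpha> n) * Re (u * (S n + \<eta> n))" for n
  proof -
    have "\<Lambda> n = Re (u * (\<Sum>s<M. of_int (m' n s) * v s))"
      by (simp add: \<Lambda>_def x_def sum_distrib_left Re_sum algebra_simps sum_subtractf sum.distrib)
    also have "(\<Sum>s<M. of_int (m' n s) * v s) = of_nat D * (\<Sum>j=1..N. p j n * \<theta> j)"
      using m' by simp
    also have "u * \<dots> = of_real (real D * Q n powr (- \<tau> + \<alpha> n)) * (u * (S n + \<eta> n))"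
      unfolding lin_form(3) S_def by simp
    finally show ?thesis
      by (simp only: times_complex.simps(1) Re_complex_of_real Im_complex_of_real)
  qed
  \<comment> \<open>Constants such as \<open>C\<close>, \<open>D\<close> and 2/\<kappa> are absorbed
    by an arbitrarily small power of \<open>Q n\<close>; hence the repeated splitting of
    \<open>e\<close> into halves.\<close>
  have large: "\<forall>\<^sub>F n in sequentially. b \<le> Q n powr e" if "e > 0" for b e
    using filterlim_compose[OF real_powr_at_top[OF that] Q_lim] by (simp add: filterlim_at_top)
  have "\<tau> + 1 \<le> real M"
  proof (rule card_ge_of_integer_forms_sequence[OF \<tau>, of M "\<lambda>s n. m' n s" x G])
    fix e :: real assume e: "e > 0"
    hence e2: "e / 2 > 0" by simp
    have "\<forall>\<^sub>F n in sequentially. \<forall>j\<in>{1..N}. \<epsilon> j n < e / 2"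
      using p_conj(1) e by (intro eventually_ball_finite ballI order_tendstoD(2)) auto
    with large[OF e2, of C] eventually_Q_ge[of 1]
    show "\<forall>\<^sub>F n in sequentially. \<forall>s<M. \<bar>real_of_int (m' n s)\<bar> \<le> Q n powr (1 + e)"
    proof eventually_elim
      case (elim n)
      show ?case
      proof (intro allI impI)
        fix s assume s: "s < M"
        have "cmod z \<le> Q n powr (1 + e / 2)" if "j \<in> {1..N}" "z \<in> galois_conjugates (p j n)" for j z
        proof -
          have "cmod z \<le> Q n powr (1 + \<epsilon> j n)" using p_conj(2)[OF that] by simp
          also have "\<dots> \<le> Q n powr (1 + e / 2)" 
            using elim(2) bspec[OF elim(3) that(1)] by (intro powr_mono) auto
          finally show ?thesis .
        qed
        hence "\<bar>real_of_int (m' n s)\<bar> \<le> C * Q n powr (1 + e / 2)" using m' s by simp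
        also have "\<dots> \<le> Q n powr (e / 2) * Q n powr (1 + e / 2)"
          using elim e by (intro mult_right_mono) auto
        also have "\<dots> = Q n powr (1 + e)" by (simp add: powr_add[symmetric] add.commute)
        finally show "\<bar>real_of_int (m' n s)\<bar> \<le> Q n powr (1 + e)" .
      qed
    qed
    have "\<forall>\<^sub>F n in sequentially. \<alpha> n < e / 2" using lin_form(1) e by (intro order_tendstoD(2)) auto
    moreover have "\<forall>\<^sub>F n in sequentially. cmod (\<eta> n) < 1"
      using tendsto_norm[OF lin_form(2)] by (intro order_tendstoD(2)) auto
    ultimately show "\<forall>\<^sub>F n in sequentially. \<bar>\<Sum>s<M. real_of_int (m' n s) * x s\<bar> \<le> Q n powr (- \<tau> + e)"
      using large[OF e2, of "real D * ((\<Sum>t=1..T. cmod (c t)) + 1)"] eventually_Q_ge[of 1]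
    proof eventually_elim
      case (elim n)
      have "cmod (S n) \<le> (\<Sum>t=1..T. cmod (c t))"
        unfolding S_def using \<zeta>_norm by (intro sum_norm_le) (simp add: norm_mult norm_power)
      hence "cmod (u * (S n + \<eta> n)) \<le> (\<Sum>t=1..T. cmod (c t)) + 1"
        using elim(2) norm_triangle_ineq[of "S n" "\<eta> n"] by (simp add: norm_mult u)
      hence Re: "\<bar>Re (u * (S n + \<eta> n))\<bar> \<le> (\<Sum>t=1..T. cmod (c t)) + 1"
        using abs_Re_le_cmod order.trans by blast
      have "\<bar>\<Lambda> n\<bar> = Q n powr (- \<tau> + \<alpha> n) * (real D * \<bar>Re (u * (S n + \<eta> n))\<bar>)"
        unfolding \<Lambda> by (simp add: abs_mult)
      also have "\<dots> \<le> Q n powr (- \<tau> + e / 2) * Q n powr (e / 2)"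
      proof (rule mult_mono)
        show "Q n powr (- \<tau> + \<alpha> n) \<le> Q n powr (- \<tau> + e / 2)" using elim by (intro powr_mono) auto
        have "real D * \<bar>Re (u * (S n + \<eta> n))\<bar> \<le> real D * ((\<Sum>t=1..T. cmod (c t)) + 1)"
          using Re by (intro mult_left_mono) auto
        thus "real D * \<bar>Re (u * (S n + \<eta> n))\<bar> \<le> Q n powr (e / 2)" using elim e by linarith
      qed auto
      also have "\<dots> = Q n powr (- \<tau> + e)" by (simp add: powr_add[symmetric])
      finally show ?case by (simp add: \<Lambda>_def)
    qed
    have "\<forall>\<^sub>F n in sequentially. - e / 2 < \<alpha> n" using lin_form(1) e by (intro order_tendstoD(1)) auto
    moreover have "\<forall>\<^sub>F n in sequentially. cmod (\<eta> n) < \<kappa> / 2"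
      using tendsto_norm[OF lin_form(2)] \<kappa>(1) by (intro order_tendstoD(2)) auto
    ultimately have "\<forall>\<^sub>F n in sequentially. - e / 2 < \<alpha> n \<and> cmod (\<eta> n) < \<kappa> / 2 \<and>
        2 / \<kappa> \<le> Q n powr (e / 2) \<and> 1 \<le> Q n"
      using large[OF e2, of "2 / \<kappa>"] eventually_Q_ge[of 1] by eventually_elim auto
    \<comment> \<open>The estimates are needed at the index \<open>n + i\<close>, where
      \<open>i\<close> depends on \<open>n\<close>; a threshold \<open>n0\<close> covers all such
      indices at once.\<close>
    then obtain n0 where n0: "\<And>n. n \<ge> n0 \<Longrightarrow> - e / 2 < \<alpha> n \<and> cmod (\<eta> n) < \<kappa> / 2 \<and>
        2 / \<kappa> \<le> Q n powr (e / 2) \<and> 1 \<le> Q n"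
      unfolding eventually_sequentially by blast
    show "\<forall>\<^sub>F n in sequentially. \<exists>i<G. Q (n + i) powr (- \<tau> - e) \<le> \<bar>\<Sum>s<M. real_of_int (m' (n + i) s) * x s\<bar>"
      using eventually_ge_at_top[of n0]
    proof eventually_elim
      case (elim n)
      obtain i where i: "i < G" "\<kappa> \<le> \<bar>Re (u * S (n + i))\<bar>" using \<kappa>(2)[of n] unfolding S_def by blast
      define k where "k = n + i"
      have k: "- e / 2 < \<alpha> k" "cmod (\<eta> k) < \<kappa> / 2" "2 / \<kappa> \<le> Q k powr (e / 2)" "1 \<le> Q k"
        using n0[of k] elim by (auto simp: k_def)
      \<comment> \<open>The perturbation \<eta> costs at most half of the lower bound
        \<kappa>.\<close>
      have "\<bar>Re (u * \<eta> k)\<bar> < \<kappa> / 2"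
        using abs_Re_le_cmod[of "u * \<eta> k"] k(2) by (simp add: norm_mult u)
      moreover have "Re (u * (S k + \<eta> k)) = Re (u * S k) + Re (u * \<eta> k)"
        by (simp only: distrib_left plus_complex.sel)
      ultimately have Re: "\<kappa> / 2 \<le> \<bar>Re (u * (S k + \<eta> k))\<bar>" using i(2) unfolding k_def by linarith
      have "Q k powr (- \<tau> - e) = Q k powr (- \<tau> - e / 2) * Q k powr (- (e / 2))"
        unfolding powr_add[symmetric] by (rule arg_cong[of _ _ "\<lambda>a. Q k powr a"]) linarith
      also have "\<dots> \<le> Q k powr (- \<tau> + \<alpha> k) * (\<kappa> / 2)"
      proof (rule mult_mono)
        show "Q k powr (- \<tau> - e / 2) \<le> Q k powr (- \<tau> + \<alpha> k)" using k by (intro powr_mono) auto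
        have "inverse (Q k powr (e / 2)) \<le> inverse (2 / \<kappa>)"
          using k(3) \<kappa>(1) by (intro le_imp_inverse_le) auto
        thus "Q k powr (- (e / 2)) \<le> \<kappa> / 2" by (simp add: powr_minus)
      qed auto
      also have "\<dots> \<le> Q k powr (- \<tau> + \<alpha> k) * \<bar>Re (u * (S k + \<eta> k))\<bar>"
        using Re by (intro mult_left_mono) auto
      \<comment> \<open>As \<open>D\<close> is at least 1, the factor from clearing denominators
        only increases the value.\<close>
      also have "\<dots> \<le> real D * (Q k powr (- \<tau> + \<alpha> k) * \<bar>Re (u * (S k + \<eta> k))\<bar>)"
        using D mult_right_mono[of 1 "real D" "Q k powr (- \<tau> + \<alpha> k) * \<bar>Re (u * (S k + \<eta> k))\<bar>"]
        unfolding mult_1 by (simp only: Suc_le_eq zero_le_mult_iff powr_ge_zero abs_ge_zero One_nat_def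
          real_of_nat_ge_one_iff simp_thms)
      also have "\<dots> = \<bar>\<Lambda> k\<bar>" unfolding \<Lambda> by (simp add: abs_mult)
      finally show ?case using i(1) by (auto simp: k_def \<Lambda>_def)
    qed
  qed
  hence le: "\<tau> + 1 \<le> real (number_field_degree K) * real ((CF.dim over K) (CF.Span K (map \<theta> [1..<Suc N])))"
    by (simp add: M_def)
  \<comment> \<open>Degree 0 would make the right-hand side of \<open>le\<close> vanish, against
    \<tau> + 1 > 0; this permits the division.\<close>
  hence "number_field_degree K \<noteq> 0" using \<tau> by (intro notI) simp
  with le show ?thesis by (simp add: pos_divide_le_eq mult.commute)
qed

end
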